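(* Let $\alpha\in(0,1)$ be fixed. For each $n$, pick each integer in $\{0,1,\ldots,n\}$ independently with probability $p=p_n$, where $p_n\to 0$ as $n\to\infty$, thus getting a random set $\mathcal{A}$. Let $X=X_n$ be the number of integers $j\in[\alpha n,(2-\alpha)n]$ that cannot be written as $j=x_1+x_2$ with $x_1,x_2\in\mathcal{A}$ ($x_1=x_2$ allowed). (i) Let $\delta>0$ and let $Y=Y_n$ be a Poisson random variable with mean $\lambda=\mathbb{E}(X)$. If $$p\ge\sqrt{\frac{\left(\frac{1}{\alpha}+\delta\right)\log n}{n}},$$ then $d_{TV}(X,Y)\to 0$ as $n\to\infty$. (ii) Suppose $$p=\sqrt{\frac{\frac{2}{\alpha}\log n-\frac{2}{\alpha}\log\log n+A_n}{n}}$$ for a real sequence $(A_n)$. Then, as $n\to\infty$: - if $A_n\to\infty$, then $\mathbb{P}(\mathcal{A}\text{ is a truncated 2-basis})\to 1$; - if $A_n\to-\infty$, then $\mathbb{P}(\mathcal{A}\text{ is a truncated 2-basis})\to 0$; - if $A_n\to A\in\mathbb{R}$, then $\mathbb{P}(\mathcal{A}\text{ is a truncated 2-basis})\to\exp\left\{-2\alpha e^{-\alpha A/2}\right\}$.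
   Context: A set $\mathcal{A}\subseteq\{0,1,\ldots,n\}$ is a truncated 2-basis (with parameter $\alpha\in(0,1)$) if every integer $j\in[\alpha n,(2-\alpha)n]$ can be written as $j=x_1+x_2$ with $x_1,x_2\in\mathcal{A}$, where $x_1=x_2$ is allowed. Thus $\mathcal{A}$ is a truncated 2-basis if and only if $X=0$. For nonnegative-integer-valued random variables $X,Y$, the total variation distance between their distributions is $d_{TV}(X,Y)=\sup_{B\subseteq\mathbb{Z}_{\ge 0}}|\mathbb{P}(X\in B)-\mathbb{P}(Y\in B)|$. The numbers $p_n$ are assumed to be well-defined probabilities in $[0,1]$ (for all sufficiently large $n$). *)

theory Defs
  imports "HOL-Probability.Probability"
begin

text \<open>Law of a random subset of \<open>{0..n}\<close> containing each element independently with
  probability \<open>q\<close>; \<open>bernoulli_pmf\<close> clamps \<open>q\<close> to the unit interval, so this is the intended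
  law only for \<open>0 \<le> q \<le> 1\<close>.\<close>

definition random_subset :: "nat \<Rightarrow> real \<Rightarrow> nat set pmf" where
  "random_subset n q =
     map_pmf (\<lambda>f. {x \<in> {0..n}. f x}) (Pi_pmf {0..n} False (\<lambda>_. bernoulli_pmf q))"

text \<open>As \<open>0 \<le> \<alpha> * n\<close> in all uses, the integers \<open>j\<close> in \<open>[\<alpha> n, (2 - \<alpha>) n]\<close> may be taken
  to be natural numbers.\<close>

definition truncated_2_basis :: "real \<Rightarrow> nat \<Rightarrow> nat set \<Rightarrow> bool" where
  "truncated_2_basis \<alpha> n A \<longleftrightarrow>
     A \<subseteq> {0..n} \<and>
     (\<forall>j::nat. \<alpha> * real n \<le> real j \<and> real j \<le> (2 - \<alpha>) * real n
        \<longrightarrow> (\<exists>x1\<in>A. \<exists>x2\<in>A. j = x1 + x2))"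

definition num_missing :: "real \<Rightarrow> nat \<Rightarrow> nat set \<Rightarrow> nat" where
  "num_missing \<alpha> n A =
     card {j::nat. \<alpha> * real n \<le> real j \<and> real j \<le> (2 - \<alpha>) * real n
             \<and> \<not> (\<exists>x1\<in>A. \<exists>x2\<in>A. j = x1 + x2)}"

definition missing_pmf :: "real \<Rightarrow> nat \<Rightarrow> real \<Rightarrow> nat pmf" where
  "missing_pmf \<alpha> n q = map_pmf (num_missing \<alpha> n) (random_subset n q)"

definition mean_missing :: "real \<Rightarrow> nat \<Rightarrow> real \<Rightarrow> real" where
  "mean_missing \<alpha> n q =
     measure_pmf.expectation (random_subset n q) (\<lambda>A. real (num_missing \<alpha> n A))"

definition tv_dist :: "nat pmf \<Rightarrow> nat pmf \<Rightarrow> real" where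
  "tv_dist P Q = (SUP B. \<bar>measure_pmf.prob P B - measure_pmf.prob Q B\<bar>)"

end

theory Submission
  imports Defs "HOL-Real_Asymp.Real_Asymp"
begin

text \<open>
  Write \<open>X = \<Sum>k. I k\<close>, where \<open>I k\<close> indicates that the random set misses the sum \<open>k\<close> and \<open>k\<close> ranges
  over the integers in \<open>[\<alpha> n, (2 - \<alpha>) n]\<close>. Every \<open>I k\<close> is a decreasing function of the random set, so
  the indicators are positively correlated, and this alone puts \<open>X\<close> close to a Poisson variable
  with the same mean \<open>\<lambda>\<close> as soon as the probabilities and the covariances of the \<open>I k\<close> are small.

  Stein's equation \<open>\<lambda> f (j + 1) - j f j = 1\<^sub>B j - Po(\<lambda>)(B)\<close> reduces the total variation distance to
  comparing \<open>E (f (W + 1))\<close> with \<open>E (f (W + 1) | I k)\<close>, where \<open>W = X - I k\<close>. Such a comparison is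
  usually made by a monotone coupling; here the Harris inequality does it directly. The
  increments of \<open>f\<close> are at most \<open>1 / \<lambda>\<close>, so both \<open>W / \<lambda> + f (W + 1)\<close> and \<open>W / \<lambda> - f (W + 1)\<close> are
  increasing in \<open>W\<close>, hence decreasing in the random set, and correlating each of them with \<open>I k\<close>
  bounds the difference by \<open>Cov(W, I k) / \<lambda>\<close> (\<open>poisson_approximation_decreasing\<close>).

  For a single \<open>k\<close> the pairs \<open>{x, k - x}\<close> are disjoint, so the probability of missing \<open>k\<close> is an explicit
  product, about \<open>(1 - p\<^sup>2)\<close> to the power \<open>min k (2 n - k) / 2\<close>. For two sums \<open>j \<noteq> k\<close> the pairs of \<open>j\<close>
  and \<open>k\<close> form paths. Forbidding the pairs of \<open>k\<close> one at a time, each new pair meets at most two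
  pairs of \<open>j\<close>, and so, apart from at most three exceptional pairs with error \<open>O(p\<^sup>2)\<close>, its factor
  differs from the independent one by a relative error of order \<open>p\<^sup>3\<close> only
  (\<open>bprob_misses_misses_le\<close>). The total relative error is of order \<open>n p\<^sup>3\<close>, and the distance is
  at most \<open>M + \<lambda> (exp (O(n p\<^sup>3)) - 1)\<close> with \<open>M\<close> the largest single probability. Since \<open>\<lambda>\<close> is at most of
  order \<open>n exp (- \<alpha> n p\<^sup>2 / 2)\<close>, this vanishes once \<open>n p\<^sup>2\<close> is at least
  \<open>(1/\<alpha> + \<delta>) log n\<close>.

  In the window of the second part \<open>\<lambda>\<close> is a sum of two geometric series dominated by their terms near
  \<open>\<alpha> n\<close>, so \<open>\<lambda>\<close> is asymptotic to \<open>(4 / p\<^sup>2) exp (- \<alpha> n p\<^sup>2 / 2)\<close>, which tends to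
  \<open>2 \<alpha> exp (- \<alpha> A / 2)\<close> (\<open>mean_missing_critical_tendsto\<close>). The Poisson approximation then gives the
  critical limit. If \<open>A\<^sub>n\<close> tends to infinity, then \<open>\<lambda>\<close> tends to \<open>0\<close> and the first moment suffices; if
  \<open>A\<^sub>n\<close> tends to minus infinity, monotonicity in \<open>p\<close> compares with critical windows
  whose limits are arbitrarily small.
\<close>

section \<open>Finite product measure and the Harris inequality\<close>

text \<open>Expectation of \<open>f\<close> over the random subset of \<open>V\<close> that keeps each element independently with
  probability \<open>q\<close>, written as a finite sum so that its properties follow by induction on \<open>V\<close>
  through conditioning on one element (\<open>bexp_insert\<close>).\<close>

definition bexp :: "'a set \<Rightarrow> real \<Rightarrow> ('a set \<Rightarrow> real) \<Rightarrow> real" where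
  "bexp V q f = (\<Sum>S\<in>Pow V. q ^ card S * (1 - q) ^ card (V - S) * f S)"

abbreviation bprob :: "'a set \<Rightarrow> real \<Rightarrow> ('a set \<Rightarrow> bool) \<Rightarrow> real" where
  "bprob V q D \<equiv> bexp V q (\<lambda>S. of_bool (D S))"

lemma bexp_empty [simp]: "bexp {} q f = f {}"
  by (simp add: bexp_def)

lemma bexp_insert:
  assumes "finite V" "x \<notin> V"
  shows "bexp (insert x V) q f = q * bexp V q (\<lambda>S. f (insert x S)) + (1 - q) * bexp V q f"
proof -
  let ?w = "\<lambda>S. q ^ card S * (1 - q) ^ card (insert x V - S) * f S"
  have disj: "Pow V \<inter> insert x ` Pow V = {}" using assms by auto
  have inj: "inj_on (insert x) (Pow V)"
    using assms by (intro inj_onI) (metis PowD insert_ident subsetD)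
  have "bexp (insert x V) q f = sum ?w (Pow V) + sum ?w (insert x ` Pow V)"
    unfolding bexp_def Pow_insert using assms disj by (intro sum.union_disjoint) auto
  also have "sum ?w (insert x ` Pow V) = (\<Sum>S\<in>Pow V. ?w (insert x S))"
    using inj by (simp add: sum.reindex)
  also have "\<dots> = q * bexp V q (\<lambda>S. f (insert x S))"
    unfolding bexp_def sum_distrib_left
  proof (rule sum.cong[OF refl])
    fix S assume S: "S \<in> Pow V"
    then have "finite S" "x \<notin> S" "insert x V - insert x S = V - S"
      using assms finite_subset by auto
    then show "?w (insert x S) = q * (q ^ card S * (1 - q) ^ card (V - S) * f (insert x S))"
      by simp
  qed
  also have "sum ?w (Pow V) = (1 - q) * bexp V q f"
    unfolding bexp_def sum_distrib_left
  proof (rule sum.cong[OF refl])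
    fix S assume S: "S \<in> Pow V"
    then have "insert x V - S = insert x (V - S)" using assms by auto
    then have "card (insert x V - S) = Suc (card (V - S))" using assms by simp
    then show "?w S = (1 - q) * (q ^ card S * (1 - q) ^ card (V - S) * f S)"
      by simp
  qed
  finally show ?thesis by simp
qed

lemma bexp_cong: "(\<And>S. S \<subseteq> V \<Longrightarrow> f S = g S) \<Longrightarrow> bexp V q f = bexp V q g"
  unfolding bexp_def by (intro sum.cong) auto

lemma bexp_mono:
  assumes "0 \<le> q" "q \<le> 1" "\<And>S. S \<subseteq> V \<Longrightarrow> f S \<le> g S"
  shows "bexp V q f \<le> bexp V q g"
  unfolding bexp_def using assms by (intro sum_mono mult_left_mono) auto

lemma bexp_const [simp]: "finite V \<Longrightarrow> bexp V q (\<lambda>_. c) = c"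
  by (induction V rule: finite_induct) (auto simp: bexp_insert algebra_simps)

lemma bexp_add: "bexp V q (\<lambda>S. f S + g S) = bexp V q f + bexp V q g"
  by (simp add: bexp_def algebra_simps sum.distrib)

lemma bexp_diff: "bexp V q (\<lambda>S. f S - g S) = bexp V q f - bexp V q g"
  by (simp add: bexp_def algebra_simps sum_subtractf)

lemma bexp_cmult: "bexp V q (\<lambda>S. c * f S) = c * bexp V q f"
  by (simp add: bexp_def sum_distrib_left algebra_simps)

lemma bexp_sum: "bexp V q (\<lambda>S. \<Sum>k\<in>K. f k S) = (\<Sum>k\<in>K. bexp V q (f k))"
  unfolding bexp_def by (subst sum.swap) (simp add: sum_distrib_left)

lemma bexp_abs_le:
  assumes "0 \<le> q" "q \<le> 1" "\<And>S. S \<subseteq> V \<Longrightarrow> \<bar>f S\<bar> \<le> g S"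
  shows "\<bar>bexp V q f\<bar> \<le> bexp V q g"
proof -
  have "\<bar>bexp V q f\<bar> \<le> bexp V q (\<lambda>S. \<bar>f S\<bar>)"
    unfolding bexp_def using assms(1,2) by (intro order_trans[OF sum_abs]) (auto simp: abs_mult)
  also have "\<dots> \<le> bexp V q g" using assms by (intro bexp_mono) auto
  finally show ?thesis .
qed

lemma bexp_nonneg:
  "0 \<le> q \<Longrightarrow> q \<le> 1 \<Longrightarrow> (\<And>S. S \<subseteq> V \<Longrightarrow> 0 \<le> f S) \<Longrightarrow> 0 \<le> bexp V q f"
  unfolding bexp_def by (intro sum_nonneg) auto

text \<open>The Harris (FKG) inequality. Conditioning on whether \<open>x\<close> is present leaves, besides the induction
  hypotheses, the covariance of two functions of one Bernoulli variable, which is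
  \<open>q (1 - q)\<close> times a product of two differences of the same sign.\<close>

lemma harris_decreasing:
  assumes "finite V" "0 \<le> q" "q \<le> 1"
    and "\<And>S T. S \<subseteq> T \<Longrightarrow> T \<subseteq> V \<Longrightarrow> f T \<le> f S"
    and "\<And>S T. S \<subseteq> T \<Longrightarrow> T \<subseteq> V \<Longrightarrow> g T \<le> g S"
  shows "bexp V q f * bexp V q g \<le> bexp V q (\<lambda>S. f S * g S)"
  using assms(1,4,5)
proof (induction V arbitrary: f g rule: finite_induct)
  case empty
  then show ?case by simp
next
  case (insert x V)
  let ?f1 = "\<lambda>S. f (insert x S)" and ?g1 = "\<lambda>S. g (insert x S)"
  have "bexp V q ?f1 * bexp V q ?g1 \<le> bexp V q (\<lambda>S. ?f1 S * ?g1 S)"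
    by (rule insert.IH; rule insert.prems; blast)
  then have 1: "q * (bexp V q ?f1 * bexp V q ?g1) \<le> q * bexp V q (\<lambda>S. ?f1 S * ?g1 S)"
    using assms(2) by (rule mult_left_mono)
  have "bexp V q f * bexp V q g \<le> bexp V q (\<lambda>S. f S * g S)"
    by (rule insert.IH; rule insert.prems; blast)
  then have 0: "(1 - q) * (bexp V q f * bexp V q g) \<le> (1 - q) * bexp V q (\<lambda>S. f S * g S)"
    using assms(3) by (intro mult_left_mono) auto
  have "bexp V q ?f1 \<le> bexp V q f" "bexp V q ?g1 \<le> bexp V q g"
    by (rule bexp_mono[OF assms(2,3)]; rule insert.prems; blast)+
  then have "0 \<le> q * (1 - q) * ((bexp V q f - bexp V q ?f1) * (bexp V q g - bexp V q ?g1))"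
    using assms(2,3) by (intro mult_nonneg_nonneg) auto
  then show ?case
    using 0 1 insert.hyps by (simp add: bexp_insert algebra_simps)
qed

lemma bexp_mono_prob:
  assumes "finite V" "0 \<le> q" "q \<le> q'" "q' \<le> 1"
    and "\<And>S T. S \<subseteq> T \<Longrightarrow> T \<subseteq> V \<Longrightarrow> f S \<le> f T"
  shows "bexp V q f \<le> bexp V q' f"
  using assms(1,5)
proof (induction V arbitrary: f rule: finite_induct)
  case empty
  then show ?case by simp
next
  case (insert x V)
  let ?f1 = "\<lambda>S. f (insert x S)"
  have 1: "bexp V q ?f1 \<le> bexp V q' ?f1" and 0: "bexp V q f \<le> bexp V q' f"
    by (rule insert.IH; rule insert.prems; blast)+
  have "bexp V q' f \<le> bexp V q' ?f1"
    using assms by (intro bexp_mono insert.prems) auto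
  then have "0 \<le> (q' - q) * (bexp V q' ?f1 - bexp V q' f)"
    using assms by (intro mult_nonneg_nonneg) auto
  moreover have "q * bexp V q ?f1 \<le> q * bexp V q' ?f1" using 1 assms by (intro mult_left_mono)
  moreover have "(1 - q) * bexp V q f \<le> (1 - q) * bexp V q' f"
    using 0 assms by (intro mult_left_mono) auto
  ultimately show ?case using insert.hyps by (simp add: bexp_insert algebra_simps)
qed

text \<open>Given that \<open>U\<close> is contained in the random set, the rest of the set is distributed as before. Stating
  this with \<open>S \<union> U\<close> instead of restricting to \<open>V - U\<close> keeps all expectations over the same ground set.\<close>

lemma bexp_contains:
  assumes "finite V" "U \<subseteq> V"
  shows "bexp V q (\<lambda>S. of_bool (U \<subseteq> S) * f S) = q ^ card U * bexp V q (\<lambda>S. f (S \<union> U))"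
proof -
  have "finite U" using assms finite_subset by blast
  then show ?thesis using assms(2)
  proof (induction U arbitrary: f rule: finite_induct)
    case empty
    then show ?case by simp
  next
    case (insert x U)
    define W where "W = V - {x}"
    have W: "V = insert x W" "x \<notin> W" "finite W" using insert.prems assms(1) by (auto simp: W_def)
    have one: "bexp V q (\<lambda>S. of_bool (x \<in> S) * g S) = q * bexp V q (\<lambda>S. g (insert x S))" for g
    proof -
      have "bexp W q (\<lambda>S. of_bool (x \<in> S) * g S) = bexp W q (\<lambda>S. 0)"
        using W by (intro bexp_cong) auto
      then show ?thesis using W by (simp add: bexp_insert algebra_simps)
    qed
    have "bexp V q (\<lambda>S. of_bool (insert x U \<subseteq> S) * f S)
        = bexp V q (\<lambda>S. of_bool (x \<in> S) * (of_bool (U \<subseteq> S) * f S))"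
      by (intro bexp_cong) auto
    also have "\<dots> = q * bexp V q (\<lambda>S. of_bool (U \<subseteq> insert x S) * f (insert x S))"
      by (rule one)
    also have "\<dots> = q * bexp V q (\<lambda>S. of_bool (U \<subseteq> S) * f (insert x S))"
      using insert.hyps by (simp add: subset_insert)
    also have "\<dots> = q * (q ^ card U * bexp V q (\<lambda>S. f (insert x (S \<union> U))))"
      using insert.prems by (subst insert.IH) auto
    finally show ?case using insert.hyps by simp
  qed
qed

lemma bprob_avoids:
  assumes "finite V"
  shows "bprob V q (\<lambda>S. S \<inter> N = {}) = (1 - q) ^ card (N \<inter> V)"
  using assms
proof (induction V rule: finite_induct)
  case empty
  then show ?case by simp
next
  case (insert x V)
  show ?case
  proof (cases "x \<in> N")
    case True
    then have "N \<inter> insert x V = insert x (N \<inter> V)" by auto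
    then show ?thesis using insert True by (simp add: bexp_insert)
  next
    case False
    then show ?thesis using insert by (simp add: bexp_insert algebra_simps)
  qed
qed

text \<open>Forbidding one more set \<open>U\<close> on top of a decreasing event \<open>D\<close>. If the elements of \<open>N\<close> are the only
  obstacles to adding \<open>U\<close> without leaving \<open>D\<close>, then the Harris inequality shows that, given \<open>D\<close>, the
  set \<open>U\<close> is contained in the random set with probability at least \<open>q^|U| (1 - q)^|N|\<close>. With \<open>N\<close>
  empty this would be the factor for an independent event.\<close>

lemma bprob_avoid_step:
  assumes "finite V" "0 \<le> q" "q \<le> 1" "U \<subseteq> V"
    and dec: "\<And>S T. S \<subseteq> T \<Longrightarrow> T \<subseteq> V \<Longrightarrow> D T \<Longrightarrow> D S"
    and N: "finite N" "\<And>S. S \<subseteq> V \<Longrightarrow> D S \<Longrightarrow> S \<inter> N = {} \<Longrightarrow> D (S \<union> U)"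
  shows "bprob V q (\<lambda>S. D S \<and> \<not> U \<subseteq> S) \<le> (1 - q ^ card U * (1 - q) ^ card N) * bprob V q D"
proof -
  have "(1 - q) ^ card N \<le> (1 - q) ^ card (N \<inter> V)"
    using assms by (intro power_decreasing card_mono) auto
  then have "bprob V q D * (1 - q) ^ card N \<le> bprob V q D * bprob V q (\<lambda>S. S \<inter> N = {})"
    using assms by (intro mult_left_mono bexp_nonneg) (auto simp: bprob_avoids)
  also have "\<dots> \<le> bexp V q (\<lambda>S. of_bool (D S) * of_bool (S \<inter> N = {}))"
    using assms by (intro harris_decreasing) (auto intro: dec split: if_splits)
  also have "\<dots> \<le> bprob V q (\<lambda>S. D (S \<union> U))"
    using assms by (intro bexp_mono) auto
  finally have "q ^ card U * (bprob V q D * (1 - q) ^ card N)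
      \<le> q ^ card U * bprob V q (\<lambda>S. D (S \<union> U))"
    using assms by (intro mult_left_mono) auto
  also have "\<dots> = bexp V q (\<lambda>S. of_bool (U \<subseteq> S) * of_bool (D S))"
    using bexp_contains[OF assms(1,4), of q "\<lambda>S. of_bool (D S)"] by simp
  also have "\<dots> = bprob V q D - bprob V q (\<lambda>S. D S \<and> \<not> U \<subseteq> S)"
    unfolding bexp_diff[symmetric] by (intro bexp_cong) auto
  finally show ?thesis by (simp add: algebra_simps)
qed

lemma bprob_avoid_disjoint:
  assumes "finite V" "finite T" "\<And>x. x \<in> T \<Longrightarrow> U x \<subseteq> V" "disjoint_family_on U T"
  shows "bprob V q (\<lambda>S. \<forall>x\<in>T. \<not> U x \<subseteq> S) = (\<Prod>x\<in>T. 1 - q ^ card (U x))"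
  using assms(2,3,4)
proof (induction T rule: finite_induct)
  case empty
  then show ?case using assms(1) by simp
next
  case (insert x T)
  let ?D = "\<lambda>S. \<forall>y\<in>T. \<not> U y \<subseteq> S"
  have disj: "U x \<inter> U y = {}" if "y \<in> T" for y
    using insert that by (auto simp: disjoint_family_on_def)
  have same: "?D (S \<union> U x) = ?D S" for S
    using disj by blast
  have "bprob V q (\<lambda>S. \<forall>y\<in>insert x T. \<not> U y \<subseteq> S)
      = bprob V q ?D - bexp V q (\<lambda>S. of_bool (U x \<subseteq> S) * of_bool (?D S))"
    unfolding bexp_diff[symmetric] by (intro bexp_cong) auto
  also have "\<dots> = (1 - q ^ card (U x)) * bprob V q ?D"
    using bexp_contains[OF assms(1), of "U x" q "\<lambda>S. of_bool (?D S)"] insert.prems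
    by (simp only: same) (simp add: algebra_simps)
  also have "bprob V q ?D = (\<Prod>x\<in>T. 1 - q ^ card (U x))"
    using insert by (intro insert.IH) (auto simp: disjoint_family_on_def)
  finally show ?case using insert by simp
qed

section \<open>Stein's equation for the Poisson distribution\<close>

text \<open>The solution of Stein's equation \<open>l f (j + 1) - j f j = 1\<^sub>B j - Po(l)(B)\<close>. At \<open>j = 0\<close> the quotient is
  \<open>0 / 0 = 0\<close>, a harmless choice because the equation multiplies \<open>f 0\<close> by \<open>0\<close>.\<close>

definition stein_solution :: "real \<Rightarrow> nat set \<Rightarrow> nat \<Rightarrow> real" where
  "stein_solution l B j =
     (measure (poisson_pmf l) (B \<inter> {..<j}) - measure (poisson_pmf l) B * measure (poisson_pmf l) {..<j})
     / (real j * pmf (poisson_pmf l) j)"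

lemma measure_pmf_insert:
  "j \<notin> A \<Longrightarrow> measure (measure_pmf M) (insert j A) = pmf M j + measure (measure_pmf M) A"
  using measure_pmf.finite_measure_Union[of "{j}" M A] by (simp add: measure_pmf_single)

lemma measure_pmf_Int_lessThan_Suc:
  fixes M :: "nat pmf"
  shows "measure M (B \<inter> {..<Suc j}) = measure M (B \<inter> {..<j}) + of_bool (j \<in> B) * pmf M j"
proof (cases "j \<in> B")
  case True
  then have "B \<inter> {..<Suc j} = insert j (B \<inter> {..<j})" by auto
  then show ?thesis using True by (simp add: measure_pmf_insert)
next
  case False
  then have "B \<inter> {..<Suc j} = B \<inter> {..<j}" using less_Suc_eq by auto
  then show ?thesis using False by simp
qed

lemma measure_pmf_lessThan_Suc:
  fixes M :: "nat pmf"
  shows "measure M {..<Suc j} = measure M {..<j} + pmf M j"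
  using measure_pmf_Int_lessThan_Suc[of M UNIV j] by simp

text \<open>The recursion that characterises the Poisson weights; it turns index shifts into the tail
  estimates below.\<close>

lemma poisson_pmf_Suc:
  assumes "0 < l"
  shows "real (Suc j) * pmf (poisson_pmf l) (Suc j) = l * pmf (poisson_pmf l) j"
proof -
  have "real (Suc j) * (l ^ Suc j / fact (Suc j)) = l * (l ^ j / fact j)"
    by (simp add: fact_Suc del: of_nat_Suc)
  then show ?thesis using assms by (simp del: of_nat_Suc)
qed

lemma stein_equation:
  assumes "0 < l"
  shows "l * stein_solution l B (Suc j) - real j * stein_solution l B j
           = of_bool (j \<in> B) - measure (poisson_pmf l) B"
proof -
  let ?M = "poisson_pmf l"
  let ?G = "\<lambda>j. measure ?M (B \<inter> {..<j}) - measure ?M B * measure ?M {..<j}"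
  have pos: "pmf ?M j > 0" using assms by simp
  have "l * stein_solution l B (Suc j) = ?G (Suc j) / pmf ?M j"
    unfolding stein_solution_def poisson_pmf_Suc[OF assms] using assms by simp
  moreover have "real j * stein_solution l B j = ?G j / pmf ?M j"
    by (cases "j = 0") (simp_all add: stein_solution_def del: pmf_poisson)
  moreover have "?G (Suc j) - ?G j = (of_bool (j \<in> B) - measure ?M B) * pmf ?M j"
    by (simp add: measure_pmf_Int_lessThan_Suc measure_pmf_lessThan_Suc algebra_simps del: pmf_poisson)
  ultimately show ?thesis using pos by (simp add: diff_divide_distrib[symmetric] del: pmf_poisson)
qed

text \<open>Equivalently, \<open>Po{..<j} / (j Po{j})\<close> increases with \<open>j\<close>. Shifting the index by one with
  \<open>poisson_pmf_Suc\<close> turns the factor \<open>l\<close> into factors that are at most \<open>j\<close>.\<close>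

lemma poisson_initial_segment_le:
  assumes "0 < l"
  shows "l * measure (poisson_pmf l) {..<j} \<le> real j * measure (poisson_pmf l) {..<Suc j}"
proof -
  let ?M = "poisson_pmf l"
  have "l * measure ?M {..<j} = (\<Sum>i<j. real (Suc i) * pmf ?M (Suc i))"
    unfolding poisson_pmf_Suc[OF assms] by (simp add: measure_measure_pmf_finite sum_distrib_left del: pmf_poisson)
  also have "\<dots> \<le> (\<Sum>i<j. real j * pmf ?M (Suc i))"
    by (intro sum_mono mult_right_mono) auto
  also have "\<dots> = real j * (\<Sum>i<j. pmf ?M (Suc i))" by (simp add: sum_distrib_left)
  also have "(\<Sum>i<j. pmf ?M (Suc i)) \<le> (\<Sum>i<Suc j. pmf ?M i)"
    unfolding sum.lessThan_Suc_shift by simp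
  also have "\<dots> = measure ?M {..<Suc j}"
    by (simp add: measure_measure_pmf_finite del: pmf_poisson)
  finally show ?thesis by (simp add: mult_left_mono del: pmf_poisson)
qed

lemma poisson_tail_sums:
  assumes "0 < l"
  shows "(\<lambda>i. pmf (poisson_pmf l) (i + j)) sums measure (poisson_pmf l) {j..}"
proof -
  let ?M = "poisson_pmf l"
  have "(\<lambda>i. l ^ i /\<^sub>R fact i * exp (- l)) sums (exp l * exp (- l))"
    by (intro sums_mult2 exp_converges)
  then have "(\<lambda>i. pmf ?M i) sums 1"
    using assms by (simp add: exp_minus_inverse divide_inverse_commute)
  then have "(\<lambda>i. pmf ?M (i + j)) sums (1 - (\<Sum>i<j. pmf ?M i))"
    by (rule sums_split_initial_segment)
  moreover have "{j..} = space ?M - {..<j}" by auto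
  then have "measure ?M {j..} = 1 - (\<Sum>i<j. pmf ?M i)"
    by (simp only: measure_pmf.prob_compl sets_measure_pmf UNIV_I)
       (simp add: measure_measure_pmf_finite del: pmf_poisson)
  ultimately show ?thesis by simp
qed

text \<open>Equivalently, \<open>Po{j..} / (j Po{j})\<close> decreases with \<open>j\<close>; the companion of
  \<open>poisson_initial_segment_le\<close> for upper tails.\<close>

lemma poisson_tail_le:
  assumes "0 < l"
  shows "real j * measure (poisson_pmf l) {Suc j..} \<le> l * measure (poisson_pmf l) {j..}"
proof (rule sums_le)
  let ?M = "poisson_pmf l"
  show "(\<lambda>i. real j * pmf ?M (i + Suc j)) sums (real j * measure ?M {Suc j..})"
    by (intro sums_mult poisson_tail_sums assms)
  show "(\<lambda>i. l * pmf ?M (i + j)) sums (l * measure ?M {j..})"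
    by (intro sums_mult poisson_tail_sums assms)
  fix i
  have "real j * pmf ?M (i + Suc j) \<le> real (Suc (i + j)) * pmf ?M (Suc (i + j))"
    by (simp add: mult_right_mono del: pmf_poisson)
  then show "real j * pmf ?M (i + Suc j) \<le> l * pmf ?M (i + j)"
    unfolding poisson_pmf_Suc[OF assms] .
qed

text \<open>This turns upper bounds for the increments, valid for all sets, into lower bounds.\<close>

lemma stein_solution_Compl:
  "stein_solution l (- B) j = - stein_solution l B j"
proof -
  let ?M = "poisson_pmf l"
  have 1: "measure ?M (- B) = 1 - measure ?M B"
    using measure_pmf.prob_compl[of B ?M] by (simp add: Compl_eq_Diff_UNIV)
  have "measure ?M {..<j} = measure ?M (B \<inter> {..<j}) + measure ?M (- B \<inter> {..<j})"
    by (subst measure_pmf.finite_measure_Union[symmetric]) (auto intro!: arg_cong[where f="measure ?M"])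
  then have 2: "measure ?M (- B \<inter> {..<j}) = measure ?M {..<j} - measure ?M (B \<inter> {..<j})" by simp
  show ?thesis unfolding stein_solution_def 1 2
    unfolding minus_divide_left by (intro arg_cong2[where f="(/)"]) (auto simp: algebra_simps)
qed

text \<open>Split \<open>Po(B)\<close> into its parts below, at and above \<open>j\<close>. By the monotonicity of the two tail ratios
  the parts below and above contribute nonpositive amounts, so the extreme case is \<open>B = {j}\<close>.\<close>

lemma stein_solution_increment_le:
  assumes "0 < l" "0 < j"
  shows "stein_solution l B (Suc j) - stein_solution l B j \<le> 1 / l"
proof -
  let ?M = "poisson_pmf l"
  define w where "w = pmf ?M j"
  define F where "F = measure ?M {..<j}"
  define G where "G = measure ?M {Suc j..}"
  define b0 where "b0 = measure ?M (B \<inter> {..<j})"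
  define b1 where "b1 = measure ?M (B \<inter> {Suc j..})"
  define e where "e = (of_bool (j \<in> B) :: real)"
  have w: "w > 0" using assms by (simp add: w_def)
  have FG: "F + w + G = 1"
  proof -
    have "{Suc j..} = space ?M - {..<Suc j}" by auto
    then have "G = 1 - measure ?M {..<Suc j}"
      unfolding G_def by (simp only: measure_pmf.prob_compl sets_measure_pmf UNIV_I)
    then show ?thesis by (simp add: measure_pmf_lessThan_Suc F_def w_def del: pmf_poisson)
  qed
  have B: "measure ?M B = b0 + e * w + b1"
  proof -
    have "measure ?M B = measure ?M (B \<inter> {..<Suc j}) + b1"
      unfolding b1_def
      by (subst measure_pmf.finite_measure_Union[symmetric])
         (auto intro!: arg_cong[where f="measure ?M"])
    then show ?thesis by (simp add: measure_pmf_Int_lessThan_Suc b0_def e_def w_def del: pmf_poisson)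
  qed
  have ge: "0 \<le> b0" "0 \<le> b1" "0 \<le> F" "0 \<le> G" "0 \<le> e" "e \<le> 1"
    by (auto simp: b0_def b1_def F_def G_def e_def)
  have Fle: "l * F \<le> j * (F + w)"
    using poisson_initial_segment_le[OF assms(1), of j]
    by (simp add: measure_pmf_lessThan_Suc F_def w_def del: pmf_poisson)
  have Gle: "j * G \<le> l * (w + G)"
  proof -
    have "{j..} = insert j {Suc j..}" by auto
    then have "measure ?M {j..} = w + G"
      unfolding G_def w_def by (simp add: measure_pmf_insert del: pmf_poisson)
    then show ?thesis using poisson_tail_le[OF assms(1), of j] by (simp add: G_def)
  qed
  have s1: "stein_solution l B (Suc j) = (b0 + e * w - (b0 + e * w + b1) * (F + w)) / (l * w)"
    unfolding stein_solution_def poisson_pmf_Suc[OF assms(1)] B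
    by (simp add: measure_pmf_Int_lessThan_Suc measure_pmf_lessThan_Suc b0_def e_def w_def F_def del: pmf_poisson)
  have s0: "stein_solution l B j = (b0 - (b0 + e * w + b1) * F) / (j * w)"
    unfolding stein_solution_def B by (simp add: b0_def F_def w_def del: pmf_poisson)
  have G: "G = 1 - F - w" using FG by simp
  \<comment> \<open>The increment, multiplied by \<open>l j Po{j}\<close>, regrouped by the three parts of \<open>B\<close>.\<close>
  have "j * (b0 + e * w - (b0 + e * w + b1) * (F + w)) - l * (b0 - (b0 + e * w + b1) * F)
      = b0 * (j * G - l * (w + G)) + b1 * (l * F - j * (F + w)) + e * w * (j * G + l * F)"
    unfolding G by (simp add: algebra_simps)
  also have "\<dots> \<le> e * w * (j * G + l * F)"
    using ge Fle Gle mult_nonneg_nonpos[of b0 "j * G - l * (w + G)"] mult_nonneg_nonpos[of b1 "l * F - j * (F + w)"]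
    by linarith
  also have "\<dots> \<le> w * (j * G + l * F)"
    using ge assms w by (intro mult_right_mono mult_left_le_one_le) auto
  also have "\<dots> \<le> w * j"
    using Fle FG w
    by (intro mult_left_mono) (auto simp: G algebra_simps)
  finally have *: "j * (b0 + e * w - (b0 + e * w + b1) * (F + w)) - l * (b0 - (b0 + e * w + b1) * F) \<le> w * j" .
  have "stein_solution l B (Suc j) - stein_solution l B j
     = (j * (b0 + e * w - (b0 + e * w + b1) * (F + w)) - l * (b0 - (b0 + e * w + b1) * F)) / (l * w * j)"
    unfolding s1 s0 using assms w by (simp add: field_simps)
  also have "\<dots> \<le> (w * j) / (l * w * j)"
    using * assms w by (intro divide_right_mono) auto
  also have "\<dots> = 1 / l" using assms w by simp
  finally show ?thesis .
qed

lemma abs_stein_solution_increment_le: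
  assumes "0 < l" "0 < j"
  shows "\<bar>stein_solution l B (Suc j) - stein_solution l B j\<bar> \<le> 1 / l"
  using stein_solution_increment_le[OF assms, of B] stein_solution_increment_le[OF assms, of "- B"]
  by (simp add: stein_solution_Compl abs_le_iff)

section \<open>Poisson approximation for sums of decreasing indicators\<close>

text \<open>The Stein-Chen bound for positively correlated indicators. The expectation of
  Stein's equation is a sum over \<open>k\<close> of \<open>P(I k) E f(X + 1) - E(I k f(X))\<close>. Replacing \<open>X + 1\<close> by
  \<open>W k + 1\<close>, with \<open>W k\<close> the count without \<open>k\<close>, costs \<open>P(I k)\<^sup>2 / l\<close>, and the remaining difference is the
  covariance of \<open>f(W k + 1)\<close> and \<open>I k\<close>, which the Harris inequality bounds by \<open>Cov(W k, I k) / l\<close>.\<close>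

lemma poisson_approximation_decreasing:
  fixes I :: "'k \<Rightarrow> 'a set \<Rightarrow> bool" and q :: real
  assumes V: "finite V" and K: "finite K" and q: "0 \<le> q" "q \<le> 1"
    and dec: "\<And>k S T. k \<in> K \<Longrightarrow> S \<subseteq> T \<Longrightarrow> T \<subseteq> V \<Longrightarrow> I k T \<Longrightarrow> I k S"
    and l: "l = (\<Sum>k\<in>K. bprob V q (I k))" "0 < l"
  shows "\<bar>bprob V q (\<lambda>S. card {k\<in>K. I k S} \<in> B) - measure (poisson_pmf l) B\<bar>
    \<le> (\<Sum>k\<in>K. (bprob V q (I k))\<^sup>2 + (\<Sum>j\<in>K - {k}.
          bprob V q (\<lambda>S. I j S \<and> I k S) - bprob V q (I j) * bprob V q (I k))) / l"
proof -
  define f where "f = stein_solution l B"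
  define X where "X S = card {k\<in>K. I k S}" for S
  define W where "W k S = card {j\<in>K - {k}. I j S}" for k S
  define \<pi> where "\<pi> k = bprob V q (I k)" for k
  define g where "g k S = f (Suc (W k S))" for k S
  have incr: "\<bar>f (Suc (Suc w)) - f (Suc w)\<bar> \<le> 1 / l" for w
    unfolding f_def using l(2) by (intro abs_stein_solution_increment_le) auto
  have \<pi>0: "0 \<le> \<pi> k" for k
    unfolding \<pi>_def using q by (intro bexp_nonneg) auto
  have X_eq: "X S = W k S + of_bool (I k S)" if "k \<in> K" for k S
  proof -
    have "{j\<in>K. I j S} = {j\<in>K - {k}. I j S} \<union> {j. j = k \<and> I k S}" using that by auto
    then have "card {j\<in>K. I j S} = card {j\<in>K - {k}. I j S} + card {j. j = k \<and> I k S}"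
      using K by (simp only:) (subst card_Un_disjoint, auto)
    then show ?thesis by (cases "I k S") (auto simp: X_def W_def)
  qed
  have W_sum: "real (W k S) = (\<Sum>j\<in>K - {k}. of_bool (I j S))" for k S
    using K by (simp add: W_def Int_def)
  have X_sum: "real (X S) = (\<Sum>j\<in>K. of_bool (I j S))" for S
    using K by (simp add: X_def Int_def)
  have W_dec: "W k T \<le> W k S" if "S \<subseteq> T" "T \<subseteq> V" for k S T
    unfolding W_def using K that dec by (intro card_mono) auto
  have I_g: "of_bool (I k S) * f (X S) = of_bool (I k S) * g k S" if "k \<in> K" for k S
    using X_eq[OF that] by (simp add: g_def)
  have near: "\<bar>\<pi> k * bexp V q (\<lambda>S. f (Suc (X S))) - bexp V q (\<lambda>S. of_bool (I k S) * g k S)\<bar>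
    \<le> ((\<pi> k)\<^sup>2 + (\<Sum>j\<in>K - {k}. bprob V q (\<lambda>S. I j S \<and> I k S) - \<pi> j * \<pi> k)) / l"
    if k: "k \<in> K" for k
  proof -
    have "\<bar>bexp V q (\<lambda>S. f (Suc (X S)) - g k S)\<bar> \<le> bexp V q (\<lambda>S. (1 / l) * of_bool (I k S))"
    proof (rule bexp_abs_le[OF q])
      fix S
      show "\<bar>f (Suc (X S)) - g k S\<bar> \<le> (1 / l) * of_bool (I k S)"
        using incr[of "W k S"] by (auto simp: X_eq[OF k] g_def)
    qed
    then have "\<bar>bexp V q (\<lambda>S. f (Suc (X S))) - bexp V q (g k)\<bar> \<le> \<pi> k / l"
      unfolding bexp_diff bexp_cmult \<pi>_def by simp
    then have "\<pi> k * \<bar>bexp V q (\<lambda>S. f (Suc (X S))) - bexp V q (g k)\<bar> \<le> \<pi> k * (\<pi> k / l)"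
      by (rule mult_left_mono[OF _ \<pi>0])
    then have 1: "\<bar>\<pi> k * bexp V q (\<lambda>S. f (Suc (X S))) - \<pi> k * bexp V q (g k)\<bar> \<le> (\<pi> k)\<^sup>2 / l"
      using \<pi>0[of k] by (simp add: abs_mult right_diff_distrib[symmetric] power2_eq_square)
    \<comment> \<open>Adding \<open>W k / l\<close> absorbs the increments of \<open>f\<close>, whatever their sign, and makes the function monotone.\<close>
    have harris: "bexp V q (\<lambda>S. real (W k S) / l + s * g k S) * \<pi> k
        \<le> bexp V q (\<lambda>S. (real (W k S) / l + s * g k S) * of_bool (I k S))"
      if s: "s = 1 \<or> s = -1" for s
      unfolding \<pi>_def
    proof (rule harris_decreasing[OF V q])
      have "mono (\<lambda>w. real w / l + s * f (Suc w))"
      proof (rule mono_onI[where A=UNIV, simplified], rule lift_Suc_mono_le)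
        fix w
        have "s * f (Suc w) - s * f (Suc (Suc w)) \<le> 1 / l"
          using s incr[of w] by (auto simp: abs_le_iff)
        then show "real w / l + s * f (Suc w) \<le> real (Suc w) / l + s * f (Suc (Suc w))"
          by (simp add: add_divide_distrib)
      qed
      then show "real (W k T) / l + s * g k T \<le> real (W k S) / l + s * g k S"
        if "S \<subseteq> T" "T \<subseteq> V" for S T
        using W_dec[OF that] unfolding g_def by (auto dest: monoD)
      show "of_bool (I k T) \<le> (of_bool (I k S) :: real)" if "S \<subseteq> T" "T \<subseteq> V" for S T
        using dec[OF k that] by simp
    qed
    define cv where "cv = (\<Sum>j\<in>K - {k}. bprob V q (\<lambda>S. I j S \<and> I k S) - \<pi> j * \<pi> k)"
    have cv: "cv = bexp V q (\<lambda>S. real (W k S) * of_bool (I k S)) - bexp V q (\<lambda>S. real (W k S)) * \<pi> k"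
      unfolding cv_def W_sum sum_distrib_right bexp_sum \<pi>_def sum_subtractf
      by (simp add: of_bool_conj)
    have expand1: "bexp V q (\<lambda>S. real (W k S) / l + s * g k S)
        = bexp V q (\<lambda>S. real (W k S)) / l + s * bexp V q (g k)" for s
      using bexp_cmult[of V q "1 / l" "\<lambda>S. real (W k S)"] by (simp add: bexp_add bexp_cmult)
    have expand2: "bexp V q (\<lambda>S. (real (W k S) / l + s * g k S) * of_bool (I k S))
        = bexp V q (\<lambda>S. real (W k S) * of_bool (I k S)) / l
          + s * bexp V q (\<lambda>S. of_bool (I k S) * g k S)" for s
    proof -
      have "bexp V q (\<lambda>S. (real (W k S) / l + s * g k S) * of_bool (I k S))
        = bexp V q (\<lambda>S. (1 / l) * (real (W k S) * of_bool (I k S)) + s * (of_bool (I k S) * g k S))"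
        by (simp add: algebra_simps)
      then show ?thesis by (simp only: bexp_add bexp_cmult) simp
    qed
    have "\<bar>\<pi> k * bexp V q (g k) - bexp V q (\<lambda>S. of_bool (I k S) * g k S)\<bar> \<le> cv / l"
      using harris[of 1] harris[of "-1"] unfolding expand1 expand2 cv
      by (simp add: algebra_simps diff_divide_distrib abs_le_iff)
    with 1 show ?thesis unfolding cv_def[symmetric] by (simp add: add_divide_distrib)
  qed
  have "bprob V q (\<lambda>S. X S \<in> B) - measure (poisson_pmf l) B
      = bexp V q (\<lambda>S. of_bool (X S \<in> B) - measure (poisson_pmf l) B)"
    using V by (simp add: bexp_diff)
  also have "\<dots> = bexp V q (\<lambda>S. l * f (Suc (X S)) - real (X S) * f (X S))"
    unfolding f_def stein_equation[OF l(2)] ..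
  also have "\<dots> = l * bexp V q (\<lambda>S. f (Suc (X S))) - bexp V q (\<lambda>S. real (X S) * f (X S))"
    by (simp add: bexp_diff bexp_cmult)
  also have "bexp V q (\<lambda>S. real (X S) * f (X S)) = (\<Sum>k\<in>K. bexp V q (\<lambda>S. of_bool (I k S) * f (X S)))"
    unfolding X_sum sum_distrib_right bexp_sum ..
  also have "\<dots> = (\<Sum>k\<in>K. bexp V q (\<lambda>S. of_bool (I k S) * g k S))"
    using I_g by (intro sum.cong bexp_cong) auto
  also have "l * bexp V q (\<lambda>S. f (Suc (X S))) = (\<Sum>k\<in>K. \<pi> k * bexp V q (\<lambda>S. f (Suc (X S))))"
    unfolding l(1) \<pi>_def sum_distrib_right ..
  finally have "bprob V q (\<lambda>S. X S \<in> B) - measure (poisson_pmf l) B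
     = (\<Sum>k\<in>K. \<pi> k * bexp V q (\<lambda>S. f (Suc (X S))) - bexp V q (\<lambda>S. of_bool (I k S) * g k S))"
    by (simp add: sum_subtractf)
  also have "\<bar>\<dots>\<bar> \<le> (\<Sum>k\<in>K. ((\<pi> k)\<^sup>2 + (\<Sum>j\<in>K - {k}. bprob V q (\<lambda>S. I j S \<and> I k S) - \<pi> j * \<pi> k)) / l)"
    by (rule order_trans[OF sum_abs sum_mono[OF near]])
  finally show ?thesis
    unfolding X_def \<pi>_def by (simp add: sum_divide_distrib)
qed

section \<open>Probabilities that sums are missed\<close>

definition misses :: "nat \<Rightarrow> nat set \<Rightarrow> bool" where
  "misses k S \<longleftrightarrow> \<not> (\<exists>x1\<in>S. \<exists>x2\<in>S. k = x1 + x2)"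

text \<open>The smaller summand \<open>x\<close> of each representation \<open>k = x + (k - x)\<close> within \<open>{0..n}\<close>; \<open>2 * x = k\<close> is the
  degenerate representation with equal summands.\<close>

definition summand_pairs :: "nat \<Rightarrow> nat \<Rightarrow> nat set" where
  "summand_pairs n k = {x. 2 * x \<le> k \<and> k \<le> n + x}"

lemma finite_summand_pairs [simp]: "finite (summand_pairs n k)"
  by (rule finite_subset[of _ "{0..k}"]) (auto simp: summand_pairs_def)

lemma misses_mono: "S \<subseteq> T \<Longrightarrow> misses k T \<Longrightarrow> misses k S"
  by (auto simp: misses_def)

lemma misses_iff_pairs:
  assumes "S \<subseteq> {0..n}"
  shows "misses k S \<longleftrightarrow> (\<forall>x\<in>summand_pairs n k. \<not> {x, k - x} \<subseteq> S)"
proof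
  assume "misses k S"
  moreover have "k = x + (k - x)" if "x \<in> summand_pairs n k" for x
    using that by (auto simp: summand_pairs_def)
  ultimately show "\<forall>x\<in>summand_pairs n k. \<not> {x, k - x} \<subseteq> S"
    unfolding misses_def by blast
next
  assume *: "\<forall>x\<in>summand_pairs n k. \<not> {x, k - x} \<subseteq> S"
  have no: False if "x \<in> S" "y \<in> S" "k = x + y" "x \<le> y" for x y
  proof -
    have "y \<le> n" using that assms by auto
    then have "x \<in> summand_pairs n k" using that by (auto simp: summand_pairs_def)
    then show False using * that by auto
  qed
  show "misses k S"
    unfolding misses_def using no by (metis add.commute nat_le_linear)
qed

text \<open>The sets \<open>{x, k - x}\<close> are pairwise disjoint, so the events of containing them are independent.\<close>

lemma bprob_misses:
  "bprob {0..n} q (misses k) = (\<Prod>x\<in>summand_pairs n k. 1 - q ^ card {x, k - x})"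
proof -
  have "bprob {0..n} q (misses k) = bprob {0..n} q (\<lambda>S. \<forall>x\<in>summand_pairs n k. \<not> {x, k - x} \<subseteq> S)"
    by (intro bexp_cong) (simp add: misses_iff_pairs)
  also have "\<dots> = (\<Prod>x\<in>summand_pairs n k. 1 - q ^ card {x, k - x})"
    by (intro bprob_avoid_disjoint finite_summand_pairs)
       (auto simp: summand_pairs_def disjoint_family_on_def)
  finally show ?thesis .
qed

text \<open>Powers of \<open>sqrt (1 - q\<^sup>2)\<close> unify the cases: there are about \<open>min k (2 * n - k) / 2\<close> proper pairs, and
  rounding depends on the parity of \<open>k\<close>.\<close>

lemma bprob_misses_eq:
  assumes q: "0 \<le> q" "q \<le> 1" and k: "k \<le> 2 * n"
  shows "bprob {0..n} q (misses k) =
     (if even k then (1 - q) * sqrt (1 - q\<^sup>2) ^ min k (2 * n - k)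
      else sqrt (1 - q\<^sup>2) ^ Suc (min k (2 * n - k)))"
proof -
  define r where "r = sqrt (1 - q\<^sup>2)"
  have r2: "r\<^sup>2 = 1 - q\<^sup>2" using q by (simp add: r_def power_le_one)
  let ?L = "{k - n..<(k + 1) div 2}"
  let ?g = "\<lambda>x. 1 - q ^ card {x, k - x}"
  have lt: "(\<Prod>x\<in>?L. ?g x) = r ^ (2 * card ?L)"
  proof -
    have "?g x = r\<^sup>2" if "x \<in> ?L" for x
    proof -
      have "x \<noteq> k - x" using that by auto
      then show ?thesis by (simp add: r2 power2_eq_square[of q])
    qed
    then show ?thesis by (simp add: power_mult)
  qed
  show ?thesis
  proof (cases "even k")
    case True
    then obtain h where h: "k = 2 * h" by auto
    have "summand_pairs n k = insert h ?L"
      using k h by (auto simp: summand_pairs_def)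
    then have "bprob {0..n} q (misses k) = ?g h * (\<Prod>x\<in>?L. ?g x)"
      unfolding bprob_misses using h by simp
    also have "\<dots> = (1 - q) * r ^ (2 * card ?L)"
      unfolding lt using h by simp
    also have "2 * card ?L = min k (2 * n - k)" using h k by auto
    finally show ?thesis using True by (simp add: r_def)
  next
    case False
    then obtain h where h: "k = 2 * h + 1" using oddE by blast
    have "summand_pairs n k = ?L"
      using k h by (auto simp: summand_pairs_def)
    moreover have "2 * card ?L = Suc (min k (2 * n - k))" using h k by auto
    ultimately show ?thesis
      using False lt unfolding bprob_misses by (simp add: r_def)
  qed
qed

lemma one_minus_le_sqrt:
  assumes "0 \<le> q" "q \<le> (1::real)"
  shows "1 - q \<le> sqrt (1 - q\<^sup>2)"
proof (rule real_le_rsqrt)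
  have "0 \<le> 2 * q * (1 - q)" using assms by simp
  then show "(1 - q)\<^sup>2 \<le> 1 - q\<^sup>2" by (simp add: power2_eq_square algebra_simps)
qed

lemma bprob_misses_bounds:
  assumes q: "0 \<le> q" "q \<le> 1" and k: "k \<le> 2 * n"
  shows "bprob {0..n} q (misses k) \<le> sqrt (1 - q\<^sup>2) ^ min k (2 * n - k)"
    and "(1 - q) * sqrt (1 - q\<^sup>2) ^ min k (2 * n - k) \<le> bprob {0..n} q (misses k)"
proof -
  define r where "r = sqrt (1 - q\<^sup>2)"
  have r: "0 \<le> r" "r \<le> 1" "1 - q \<le> r"
    using q one_minus_le_sqrt[OF q] by (auto simp: r_def power_le_one)
  show "bprob {0..n} q (misses k) \<le> sqrt (1 - q\<^sup>2) ^ min k (2 * n - k)"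
    unfolding bprob_misses_eq[OF assms] r_def[symmetric]
    using r q by (auto intro: mult_left_le_one_le)
  show "(1 - q) * sqrt (1 - q\<^sup>2) ^ min k (2 * n - k) \<le> bprob {0..n} q (misses k)"
    unfolding bprob_misses_eq[OF assms] r_def[symmetric]
    using r q by (auto intro: mult_right_mono)
qed

text \<open>Exponent of the relative error made when the pair \<open>{x, k - x}\<close> is treated as independent of the
  event of missing \<open>j\<close>. A generic pair costs \<open>4 q\<^sup>3\<close>. The three exceptions are the degenerate pair of \<open>k\<close>
  and the pairs through \<open>j / 2\<close>; each occurs for at most one \<open>x\<close>.\<close>

definition pair_error :: "real \<Rightarrow> nat \<Rightarrow> nat \<Rightarrow> nat \<Rightarrow> real" where
  "pair_error q j k x = 4 * q ^ 3
     + 2 * q\<^sup>2 * (of_bool (2 * x = k) + of_bool (2 * x = j) + of_bool (2 * (k - x) = j))"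

lemma sum_of_bool_le_1:
  assumes "finite T" "\<And>x y. x \<in> T \<Longrightarrow> y \<in> T \<Longrightarrow> P x \<Longrightarrow> P y \<Longrightarrow> x = y"
  shows "(\<Sum>x\<in>T. of_bool (P x)) \<le> (1::real)"
proof -
  have "card (T \<inter> {x. P x}) \<le> 1"
    using assms by (auto simp: card_le_Suc0_iff_eq)
  then show ?thesis using assms(1) by simp
qed

lemma sum_pair_error_le:
  assumes "0 \<le> q"
  shows "(\<Sum>x\<in>summand_pairs n k. pair_error q j k x) \<le> 4 * (real n + 1) * q ^ 3 + 6 * q\<^sup>2"
proof -
  let ?T = "summand_pairs n k"
  have "card ?T \<le> card {0..n}"
    by (intro card_mono) (auto simp: summand_pairs_def)
  then have "real (card ?T) \<le> real n + 1" by simp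
  then have "real (card ?T) * (4 * q ^ 3) \<le> (real n + 1) * (4 * q ^ 3)"
    using assms by (intro mult_right_mono) auto
  moreover have "(\<Sum>x\<in>?T. of_bool (2 * x = k)) + (\<Sum>x\<in>?T. of_bool (2 * x = j))
      + (\<Sum>x\<in>?T. of_bool (2 * (k - x) = j)) \<le> 1 + 1 + (1::real)"
    by (intro add_mono sum_of_bool_le_1 finite_summand_pairs) (auto simp: summand_pairs_def)
  then have "2 * q\<^sup>2 * ((\<Sum>x\<in>?T. of_bool (2 * x = k)) + (\<Sum>x\<in>?T. of_bool (2 * x = j))
      + (\<Sum>x\<in>?T. of_bool (2 * (k - x) = j))) \<le> 2 * q\<^sup>2 * 3"
    by (intro mult_left_mono) auto
  ultimately show ?thesis
    unfolding pair_error_def sum.distrib sum_distrib_left[symmetric] sum_constant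
    by (simp add: algebra_simps)
qed

text \<open>The three ways in which a factor of \<open>bprob_avoid_step\<close> is compared with its independent counterpart:
  a proper pair with two obstacles, a degenerate pair with one, and a dropped pair.\<close>

lemma avoid_pair_factor_le:
  fixes q :: real
  assumes q: "0 \<le> q" "q \<le> 1/2"
  shows "1 - q\<^sup>2 * (1 - q)\<^sup>2 \<le> (1 - q\<^sup>2) * exp (4 * q ^ 3)"
    and "1 - q * (1 - q) \<le> (1 - q) * exp (2 * q\<^sup>2)"
    and "1 \<le> (1 - q\<^sup>2) * exp (2 * q\<^sup>2)"
proof -
  have q2: "q\<^sup>2 \<le> 1/4" using power_mono[OF q(2) q(1), of 2] by (simp add: power2_eq_square)
  have "0 \<le> q ^ 3 * (2 + q - 4 * q\<^sup>2)"
    using q q2 by (intro mult_nonneg_nonneg) auto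
  then have "1 - q\<^sup>2 * (1 - q)\<^sup>2 \<le> (1 - q\<^sup>2) * (1 + 4 * q ^ 3)"
    by (simp add: power2_eq_square power3_eq_cube algebra_simps)
  also have "\<dots> \<le> (1 - q\<^sup>2) * exp (4 * q ^ 3)"
    using q2 by (intro mult_left_mono exp_ge_add_one_self) auto
  finally show "1 - q\<^sup>2 * (1 - q)\<^sup>2 \<le> (1 - q\<^sup>2) * exp (4 * q ^ 3)" .
  have "0 \<le> q\<^sup>2 * (1 - 2 * q)" using q by (intro mult_nonneg_nonneg) auto
  then have "1 - q * (1 - q) \<le> (1 - q) * (1 + 2 * q\<^sup>2)"
    by (simp add: power2_eq_square algebra_simps)
  also have "\<dots> \<le> (1 - q) * exp (2 * q\<^sup>2)"
    using q by (intro mult_left_mono exp_ge_add_one_self) auto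
  finally show "1 - q * (1 - q) \<le> (1 - q) * exp (2 * q\<^sup>2)" .
  have "0 \<le> q\<^sup>2 * (1 - 2 * q\<^sup>2)" using q2 by (intro mult_nonneg_nonneg) auto
  then have "1 \<le> (1 - q\<^sup>2) * (1 + 2 * q\<^sup>2)"
    by (simp add: power2_eq_square algebra_simps)
  also have "\<dots> \<le> (1 - q\<^sup>2) * exp (2 * q\<^sup>2)"
    using q2 by (intro mult_left_mono exp_ge_add_one_self) auto
  finally show "1 \<le> (1 - q\<^sup>2) * exp (2 * q\<^sup>2)" .
qed

text \<open>The pairs of \<open>k\<close> are forbidden one at a time. Adding \<open>U = {x, k - x}\<close> to a set that misses \<open>j\<close>
  creates the sum \<open>j\<close> only through a partner \<open>j - u\<close> of some \<open>u \<in> U\<close>, and cannot complete another pair of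
  \<open>k\<close>; so there are at most \<open>card U\<close> obstacles. This fails when \<open>j / 2 \<in> U\<close>, since then \<open>U\<close> alone
  produces \<open>j\<close>; such a pair is dropped, at the price of the larger error allowed by \<open>pair_error\<close>.\<close>

lemma bprob_misses_avoid_pairs_le:
  assumes q: "0 \<le> q" "q \<le> 1/2" and "j \<noteq> k" and "finite T" "T \<subseteq> summand_pairs n k"
  shows "bprob {0..n} q (\<lambda>S. misses j S \<and> (\<forall>x\<in>T. \<not> {x, k - x} \<subseteq> S))
    \<le> bprob {0..n} q (misses j) * (\<Prod>x\<in>T. (1 - q ^ card {x, k - x}) * exp (pair_error q j k x))"
  using assms(4,5)
proof (induction T rule: finite_induct)
  case empty
  then show ?case by simp
next
  case (insert x T)
  define D where "D S \<longleftrightarrow> misses j S \<and> (\<forall>y\<in>T. \<not> {y, k - y} \<subseteq> S)" for S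
  define U where "U = {x, k - x}"
  have D0: "0 \<le> bprob {0..n} q D" using q by (intro bexp_nonneg) auto
  have x: "2 * x \<le> k" "k \<le> n + x" using insert.prems by (auto simp: summand_pairs_def)
  have "bprob {0..n} q (\<lambda>S. misses j S \<and> (\<forall>y\<in>insert x T. \<not> {y, k - y} \<subseteq> S))
      = bprob {0..n} q (\<lambda>S. D S \<and> \<not> U \<subseteq> S)"
    unfolding D_def U_def by (intro bexp_cong) auto
  also have "\<dots> \<le> (1 - q ^ card U) * exp (pair_error q j k x) * bprob {0..n} q D"
  proof (cases "2 * x = j \<or> 2 * (k - x) = j")
    case True
    have "x \<noteq> k - x" using True x \<open>j \<noteq> k\<close> by auto
    then have cU: "card U = 2" by (simp add: U_def)
    have "2 * q\<^sup>2 * 1 \<le> 2 * q\<^sup>2 * (of_bool (2 * x = k) + of_bool (2 * x = j) + of_bool (2 * (k - x) = j))"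
      using True by (intro mult_left_mono) auto
    then have "2 * q\<^sup>2 \<le> pair_error q j k x"
      using zero_le_power[OF q(1), of 3] unfolding pair_error_def by linarith
    then have "(1 - q\<^sup>2) * exp (2 * q\<^sup>2) \<le> (1 - q\<^sup>2) * exp (pair_error q j k x)"
      using q by (intro mult_left_mono) (auto simp: power_le_one)
    then have "1 \<le> (1 - q\<^sup>2) * exp (pair_error q j k x)"
      using avoid_pair_factor_le(3)[OF q] by linarith
    then have "1 * bprob {0..n} q D \<le> (1 - q\<^sup>2) * exp (pair_error q j k x) * bprob {0..n} q D"
      using D0 by (rule mult_right_mono)
    moreover have "bprob {0..n} q (\<lambda>S. D S \<and> \<not> U \<subseteq> S) \<le> bprob {0..n} q D"
      using q by (intro bexp_mono) auto
    ultimately show ?thesis using cU by simp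
  next
    case False
    \<comment> \<open>If \<open>u > j\<close>, truncated subtraction puts \<open>0\<close> into \<open>N\<close>; a larger \<open>N\<close> is still a valid set of obstacles.\<close>
    define N where "N = (\<lambda>u. j - u) ` U"
    have "bprob {0..n} q (\<lambda>S. D S \<and> \<not> U \<subseteq> S)
        \<le> (1 - q ^ card U * (1 - q) ^ card N) * bprob {0..n} q D"
    proof (rule bprob_avoid_step)
      show "U \<subseteq> {0..n}" using x by (auto simp: U_def)
      show "D S" if "S \<subseteq> R" "D R" for S R
        using that misses_mono unfolding D_def by blast
      fix S assume S: "D S" "S \<inter> N = {}"
      have "misses j (S \<union> U)"
        unfolding misses_def
      proof (rule notI, elim bexE)
        fix y z assume yz: "y \<in> S \<union> U" "z \<in> S \<union> U" "j = y + z"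
        have "y \<notin> U \<or> z \<notin> U" using yz(3) False x \<open>j \<noteq> k\<close> by (auto simp: U_def)
        moreover have "y \<notin> S \<or> z \<notin> S" using S yz(3) by (auto simp: D_def misses_def)
        moreover have False if "u \<in> U" "v \<in> S" "j = u + v" for u v
        proof -
          have "v \<in> N" unfolding N_def using that by force
          then show False using S that by auto
        qed
        ultimately show False using yz by (metis UnE add.commute)
      qed
      moreover have "\<not> {y, k - y} \<subseteq> S \<union> U" if "y \<in> T" for y
      proof -
        have "2 * y \<le> k" "y \<noteq> x"
          using that insert by (auto simp: summand_pairs_def)
        then have "y \<notin> U" "k - y \<notin> U" using x by (auto simp: U_def)
        then show ?thesis using S that by (auto simp: D_def)
      qed
      ultimately show "D (S \<union> U)" by (simp add: D_def)
    qed (use q in \<open>simp_all add: N_def U_def\<close>)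
    also have "\<dots> \<le> ((1 - q ^ card U) * exp (pair_error q j k x)) * bprob {0..n} q D"
    proof (rule mult_right_mono[OF _ D0])
      have "card N \<le> card U" unfolding N_def by (rule card_image_le) (simp add: U_def)
      then have "q ^ card U * (1 - q) ^ card U \<le> q ^ card U * (1 - q) ^ card N"
        using q by (intro mult_left_mono power_decreasing) auto
      then have "1 - q ^ card U * (1 - q) ^ card N \<le> 1 - q ^ card U * (1 - q) ^ card U" by simp
      also have "\<dots> \<le> (1 - q ^ card U) * exp (pair_error q j k x)"
      proof (cases "2 * x = k")
        case True
        then have "k - x = x" by auto
        then have "card U = 1" by (simp add: U_def)
        moreover have "(1 - q) * exp (2 * q\<^sup>2) \<le> (1 - q) * exp (pair_error q j k x)"
          using q True by (intro mult_left_mono) (auto simp: pair_error_def)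
        ultimately show ?thesis using avoid_pair_factor_le(2)[OF q] by simp
      next
        case False
        then have "card U = 2" using x by (auto simp: U_def card_insert_if)
        moreover have "(1 - q\<^sup>2) * exp (4 * q ^ 3) \<le> (1 - q\<^sup>2) * exp (pair_error q j k x)"
          using q by (intro mult_left_mono) (auto simp: pair_error_def power_le_one)
        ultimately show ?thesis using avoid_pair_factor_le(1)[OF q] by simp
      qed
      finally show "1 - q ^ card U * (1 - q) ^ card N \<le> (1 - q ^ card U) * exp (pair_error q j k x)" .
    qed
    finally show ?thesis .
  qed
  also have "\<dots> \<le> (1 - q ^ card U) * exp (pair_error q j k x) *
      (bprob {0..n} q (misses j) * (\<Prod>x\<in>T. (1 - q ^ card {x, k - x}) * exp (pair_error q j k x)))"
    using q insert unfolding D_def by (intro mult_left_mono mult_nonneg_nonneg) (auto simp: power_le_one)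
  finally show ?case using insert.hyps by (simp add: U_def mult_ac)
qed

text \<open>At most \<open>n + 1\<close> pairs contribute to the total error, so missing two different sums is nearly
  independent while \<open>n q\<^sup>3\<close> is small.\<close>

lemma bprob_misses_misses_le:
  assumes q: "0 \<le> q" "q \<le> 1/2" and "j \<noteq> k"
  shows "bprob {0..n} q (\<lambda>S. misses j S \<and> misses k S)
    \<le> bprob {0..n} q (misses j) * bprob {0..n} q (misses k) * exp (4 * (real n + 1) * q ^ 3 + 6 * q\<^sup>2)"
proof -
  let ?T = "summand_pairs n k"
  have "bprob {0..n} q (\<lambda>S. misses j S \<and> misses k S)
      = bprob {0..n} q (\<lambda>S. misses j S \<and> (\<forall>x\<in>?T. \<not> {x, k - x} \<subseteq> S))"
    by (intro bexp_cong) (simp add: misses_iff_pairs[of _ n k])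
  also have "\<dots> \<le> bprob {0..n} q (misses j) * (\<Prod>x\<in>?T. (1 - q ^ card {x, k - x}) * exp (pair_error q j k x))"
    by (rule bprob_misses_avoid_pairs_le[OF assms]) auto
  also have "\<dots> = bprob {0..n} q (misses j) * bprob {0..n} q (misses k)
      * exp (\<Sum>x\<in>?T. pair_error q j k x)"
    by (simp add: prod.distrib exp_sum bprob_misses)
  also have "\<dots> \<le> bprob {0..n} q (misses j) * bprob {0..n} q (misses k)
      * exp (4 * (real n + 1) * q ^ 3 + 6 * q\<^sup>2)"
    using q sum_pair_error_le[OF q(1)]
    by (intro mult_left_mono mult_nonneg_nonneg bexp_nonneg) auto
  finally show ?thesis .
qed

section \<open>Passage to the random set and the total variation bound\<close>

lemma expectation_random_subset:
  assumes q: "0 \<le> q" "q \<le> 1"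
  shows "measure_pmf.expectation (random_subset n q) f = bexp {0..n} q f"
proof -
  let ?V = "{0..n}" and ?M = "Pi_pmf {0..n} False (\<lambda>_. bernoulli_pmf q)"
  have inj: "inj_on (\<lambda>S x. x \<in> S) (Pow ?V)"
    by (auto simp: inj_on_def fun_eq_iff)
  have "measure_pmf.expectation (random_subset n q) f
      = measure_pmf.expectation ?M (\<lambda>h. f {x \<in> ?V. h x})"
    by (simp add: random_subset_def)
  also have "\<dots> = (\<Sum>h\<in>(\<lambda>S x. x \<in> S) ` Pow ?V. f {x \<in> ?V. h x} * pmf ?M h)"
  proof (rule integral_measure_pmf_real)
    fix h assume "h \<in> set_pmf ?M"
    then have "h = (\<lambda>x. x \<in> {x \<in> ?V. h x})"
      using set_Pi_pmf_subset[of ?V False "\<lambda>_. bernoulli_pmf q"] by (force simp: fun_eq_iff)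
    then show "h \<in> (\<lambda>S x. x \<in> S) ` Pow ?V" by blast
  qed simp
  also have "\<dots> = (\<Sum>S\<in>Pow ?V. f {x \<in> ?V. x \<in> S} * pmf ?M (\<lambda>x. x \<in> S))"
    by (simp add: sum.reindex[OF inj])
  also have "\<dots> = bexp ?V q f"
    unfolding bexp_def
  proof (rule sum.cong[OF refl])
    fix S assume S: "S \<in> Pow ?V"
    have "pmf ?M (\<lambda>x. x \<in> S) = (\<Prod>x\<in>?V. pmf (bernoulli_pmf q) (x \<in> S))"
      using S by (subst pmf_Pi) auto
    also have "\<dots> = (\<Prod>x\<in>?V. if x \<in> S then q else 1 - q)"
      using q by (intro prod.cong) auto
    also have "\<dots> = q ^ card (?V \<inter> S) * (1 - q) ^ card (?V - S)"
      by (simp add: prod.If_cases Diff_eq)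
    also have "?V \<inter> S = S" using S by auto
    finally have "pmf ?M (\<lambda>x. x \<in> S) = q ^ card S * (1 - q) ^ card (?V - S)" .
    moreover have "{x \<in> ?V. x \<in> S} = S" using S by auto
    ultimately show "f {x \<in> ?V. x \<in> S} * pmf ?M (\<lambda>x. x \<in> S)
        = q ^ card S * (1 - q) ^ card (?V - S) * f S" by simp
  qed
  finally show ?thesis .
qed

lemma prob_random_subset:
  assumes q: "0 \<le> q" "q \<le> 1"
  shows "measure_pmf.prob (random_subset n q) {S. D S} = bprob {0..n} q D"
proof -
  have "measure_pmf.prob (random_subset n q) {S. D S}
      = measure_pmf.expectation (random_subset n q) (indicator {S. D S})"
    by simp
  also have "\<dots> = bprob {0..n} q D"
    unfolding expectation_random_subset[OF q] by (intro bexp_cong) (auto simp: indicator_def)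
  finally show ?thesis .
qed

definition targets :: "real \<Rightarrow> nat \<Rightarrow> nat set" where
  "targets \<alpha> n = {j. \<alpha> * real n \<le> real j \<and> real j \<le> (2 - \<alpha>) * real n}"

lemma targets_le:
  assumes "0 < \<alpha>" "k \<in> targets \<alpha> n"
  shows "k \<le> 2 * n" "\<alpha> * real n \<le> real (min k (2 * n - k))"
proof -
  have 1: "\<alpha> * real n \<le> real k" "real k \<le> 2 * real n - \<alpha> * real n"
    using assms by (auto simp: targets_def algebra_simps)
  moreover have "0 \<le> \<alpha> * real n" using assms by simp
  ultimately have "real k \<le> real (2 * n)" by simp
  then show "k \<le> 2 * n" by linarith
  then show "\<alpha> * real n \<le> real (min k (2 * n - k))"
    using 1 by (auto simp: min_def of_nat_diff)
qed

lemma targets_subset: "0 < \<alpha> \<Longrightarrow> targets \<alpha> n \<subseteq> {0..2 * n}"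
  using targets_le(1) by auto

lemma finite_targets: "0 < \<alpha> \<Longrightarrow> finite (targets \<alpha> n)"
  using finite_subset[OF targets_subset] by blast

lemma num_missing_eq: "num_missing \<alpha> n S = card {k \<in> targets \<alpha> n. misses k S}"
  by (simp add: num_missing_def targets_def misses_def conj_assoc)

lemma truncated_2_basis_iff:
  assumes "0 < \<alpha>" "S \<subseteq> {0..n}"
  shows "truncated_2_basis \<alpha> n S \<longleftrightarrow> num_missing \<alpha> n S = 0"
proof -
  have "num_missing \<alpha> n S = 0 \<longleftrightarrow> {k \<in> targets \<alpha> n. misses k S} = {}"
    unfolding num_missing_eq using finite_targets[OF assms(1)] by (subst card_0_eq) auto
  then show ?thesis
    using assms(2) by (auto simp: truncated_2_basis_def targets_def misses_def)
qed

lemma mean_missing_eq: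
  assumes "0 < \<alpha>" "0 \<le> q" "q \<le> 1"
  shows "mean_missing \<alpha> n q = (\<Sum>k\<in>targets \<alpha> n. bprob {0..n} q (misses k))"
  unfolding mean_missing_def expectation_random_subset[OF assms(2,3)] bexp_sum[symmetric]
  using finite_targets[OF assms(1)] by (simp add: num_missing_eq Int_def)

lemma prob_truncated_2_basis_eq:
  assumes "0 < \<alpha>" "0 \<le> q" "q \<le> 1"
  shows "measure_pmf.prob (random_subset n q) {S. truncated_2_basis \<alpha> n S}
    = bprob {0..n} q (\<lambda>S. num_missing \<alpha> n S = 0)"
  unfolding prob_random_subset[OF assms(2,3)]
  by (intro bexp_cong) (simp add: truncated_2_basis_iff[OF assms(1)])

lemma prob_missing_pmf:
  assumes "0 \<le> q" "q \<le> 1"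
  shows "measure_pmf.prob (missing_pmf \<alpha> n q) B = bprob {0..n} q (\<lambda>S. num_missing \<alpha> n S \<in> B)"
  using prob_random_subset[OF assms, of n "\<lambda>S. num_missing \<alpha> n S \<in> B"]
  by (simp add: missing_pmf_def vimage_def)

lemma prob_truncated_2_basis_mono:
  assumes "0 < \<alpha>" "0 \<le> q" "q \<le> q'" "q' \<le> 1"
  shows "measure_pmf.prob (random_subset n q) {S. truncated_2_basis \<alpha> n S}
    \<le> measure_pmf.prob (random_subset n q') {S. truncated_2_basis \<alpha> n S}"
proof -
  have "of_bool (truncated_2_basis \<alpha> n S) \<le> (of_bool (truncated_2_basis \<alpha> n T) :: real)"
    if "S \<subseteq> T" "T \<subseteq> {0..n}" for S T
    using that unfolding truncated_2_basis_def by (auto; blast)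
  then show ?thesis using assms by (simp add: prob_random_subset bexp_mono_prob)
qed

text \<open>The first moment bound \<open>P(X \<noteq> 0) \<le> E X\<close>.\<close>

lemma prob_truncated_2_basis_ge:
  assumes "0 < \<alpha>" "0 \<le> q" "q \<le> 1"
  shows "1 - mean_missing \<alpha> n q \<le> measure_pmf.prob (random_subset n q) {S. truncated_2_basis \<alpha> n S}"
proof -
  have "1 - mean_missing \<alpha> n q = bexp {0..n} q (\<lambda>S. 1 - real (num_missing \<alpha> n S))"
    by (simp add: mean_missing_def expectation_random_subset[OF assms(2,3)] bexp_diff)
  also have "\<dots> \<le> bprob {0..n} q (\<lambda>S. num_missing \<alpha> n S = 0)"
    using assms by (intro bexp_mono) auto
  finally show ?thesis unfolding prob_truncated_2_basis_eq[OF assms] .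
qed

lemma tv_dist_bounds:
  shows abs_diff_le_tv_dist: "\<bar>measure_pmf.prob P B - measure_pmf.prob Q B\<bar> \<le> tv_dist P Q"
    and tv_dist_nonneg: "0 \<le> tv_dist P Q"
proof -
  have bdd: "bdd_above (range (\<lambda>B. \<bar>measure_pmf.prob P B - measure_pmf.prob Q B\<bar>))"
  proof (rule bdd_aboveI2)
    fix B
    show "\<bar>measure_pmf.prob P B - measure_pmf.prob Q B\<bar> \<le> 1"
      using measure_pmf.prob_le_1[of P B] measure_pmf.prob_le_1[of Q B]
        measure_nonneg[of P B] measure_nonneg[of Q B] by linarith
  qed
  show *: "\<bar>measure_pmf.prob P B - measure_pmf.prob Q B\<bar> \<le> tv_dist P Q" for B
    unfolding tv_dist_def by (rule cSUP_upper[OF UNIV_I bdd])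
  show "0 \<le> tv_dist P Q" using *[of "{}"] by simp
qed

lemma sqrt_one_minus_le_exp:
  assumes "0 \<le> q" "q \<le> (1::real)"
  shows "sqrt (1 - q\<^sup>2) \<le> exp (- q\<^sup>2 / 2)"
proof (rule real_le_lsqrt)
  have "(exp (- q\<^sup>2 / 2))\<^sup>2 = exp (- q\<^sup>2)"
    by (simp add: exp_double[symmetric])
  then show "1 - q\<^sup>2 \<le> (exp (- q\<^sup>2 / 2))\<^sup>2"
    using exp_ge_add_one_self[of "- q\<^sup>2"] by simp
qed (use assms in \<open>simp_all add: power_le_one\<close>)

lemma sqrt_one_minus_power_le:
  assumes "0 \<le> q" "q \<le> 1" "x \<le> real m"
  shows "sqrt (1 - q\<^sup>2) ^ m \<le> exp (- x * q\<^sup>2 / 2)"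
proof -
  have "sqrt (1 - q\<^sup>2) ^ m \<le> exp (- q\<^sup>2 / 2) ^ m"
    using assms sqrt_one_minus_le_exp[of q] by (intro power_mono) (auto simp: power_le_one)
  also have "\<dots> = exp (- (real m * q\<^sup>2) / 2)"
    by (simp add: exp_of_nat_mult[symmetric])
  also have "\<dots> \<le> exp (- x * q\<^sup>2 / 2)"
    using assms by (simp add: mult_right_mono)
  finally show ?thesis .
qed

text \<open>Every target is missed with positive probability, and \<open>k = n\<close> is always a target; so the Poisson
  distribution with this mean is well defined.\<close>

lemma mean_missing_pos:
  assumes "0 < \<alpha>" "\<alpha> < 1" "0 \<le> q" "q < 1"
  shows "0 < mean_missing \<alpha> n q"
proof -
  have pos: "0 < bprob {0..n} q (misses k)" if "k \<in> targets \<alpha> n" for k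
  proof -
    have "q\<^sup>2 < 1" using assms by (simp add: power_less_one_iff abs_square_less_1)
    then have "0 < (1 - q) * sqrt (1 - q\<^sup>2) ^ min k (2 * n - k)"
      using assms by (intro mult_pos_pos zero_less_power) auto
    also have "\<dots> \<le> bprob {0..n} q (misses k)"
      using assms targets_le(1)[OF assms(1) that] by (intro bprob_misses_bounds) auto
    finally show ?thesis .
  qed
  have "n \<in> targets \<alpha> n"
    using assms by (auto simp: targets_def mult_left_le_one_le mult_right_le_one_le algebra_simps)
  then show ?thesis
    using assms pos finite_targets[OF assms(1)]
    by (subst mean_missing_eq) (auto intro!: sum_pos)
qed

text \<open>The bound \<open>M + l e\<close> on the distance, where \<open>M\<close> bounds the single probabilities and \<open>1 + e\<close> the ratio
  of joint to product probabilities, combined with \<open>l \<le> (2 n + 1) M\<close>.\<close>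

lemma tv_dist_missing_le:
  assumes \<alpha>: "0 < \<alpha>" "\<alpha> < 1" and q: "0 \<le> q" "q \<le> 1/2"
  shows "tv_dist (missing_pmf \<alpha> n q) (poisson_pmf (mean_missing \<alpha> n q))
    \<le> exp (- \<alpha> * real n * q\<^sup>2 / 2) *
       (1 + (2 * real n + 1) * (exp (4 * (real n + 1) * q ^ 3 + 6 * q\<^sup>2) - 1))"
proof -
  define K where "K = targets \<alpha> n"
  define l where "l = mean_missing \<alpha> n q"
  define M where "M = exp (- (\<alpha> * real n) * q\<^sup>2 / 2)"
  define e where "e = exp (4 * (real n + 1) * q ^ 3 + 6 * q\<^sup>2) - 1"
  let ?p = "\<lambda>k. bprob {0..n} q (misses k)"
  have q1: "q \<le> 1" using q by simp
  have K: "finite K" unfolding K_def using \<alpha> finite_targets by blast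
  have l: "l = (\<Sum>k\<in>K. ?p k)" unfolding l_def K_def using \<alpha> q by (intro mean_missing_eq) auto
  have l0: "0 < l" unfolding l_def using \<alpha> q by (intro mean_missing_pos) auto
  have p0: "0 \<le> ?p k" for k using q by (intro bexp_nonneg) auto
  have e0: "0 \<le> e" using q by (simp add: e_def)
  have pM: "?p k \<le> M" if "k \<in> K" for k
  proof -
    have "?p k \<le> sqrt (1 - q\<^sup>2) ^ min k (2 * n - k)"
      using q that \<alpha> targets_le(1)[of \<alpha> k n] by (intro bprob_misses_bounds) (auto simp: K_def)
    also have "\<dots> \<le> M"
      unfolding M_def using q that \<alpha> targets_le(2)[of \<alpha> k n]
      by (intro sqrt_one_minus_power_le) (auto simp: K_def)
    finally show ?thesis .
  qed
  have lM: "l \<le> (2 * real n + 1) * M"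
  proof -
    have "card K \<le> card {0..2 * n}"
      unfolding K_def using \<alpha> targets_subset by (intro card_mono) auto
    then have "real (card K) \<le> 2 * real n + 1" by simp
    moreover have "l \<le> real (card K) * M" unfolding l using pM by (rule sum_bounded_above)
    moreover have "real (card K) * M \<le> (2 * real n + 1) * M"
      using calculation(1) by (rule mult_right_mono) (simp add: M_def)
    ultimately show ?thesis by linarith
  qed
  have "\<bar>measure_pmf.prob (missing_pmf \<alpha> n q) B - measure_pmf.prob (poisson_pmf l) B\<bar>
      \<le> M * (1 + (2 * real n + 1) * e)" for B
  proof -
    have "\<bar>bprob {0..n} q (\<lambda>S. card {k\<in>K. misses k S} \<in> B) - measure (poisson_pmf l) B\<bar>
      \<le> (\<Sum>k\<in>K. (?p k)\<^sup>2 + (\<Sum>j\<in>K - {k}.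
          bprob {0..n} q (\<lambda>S. misses j S \<and> misses k S) - ?p j * ?p k)) / l"
      using K q l l0 misses_mono by (intro poisson_approximation_decreasing) auto
    also have "\<dots> \<le> (\<Sum>k\<in>K. M * ?p k + l * e * ?p k) / l"
    proof (intro divide_right_mono sum_mono add_mono)
      fix k assume k: "k \<in> K"
      show "(?p k)\<^sup>2 \<le> M * ?p k"
        using pM[OF k] p0[of k] by (simp add: power2_eq_square mult_right_mono)
      have "(\<Sum>j\<in>K - {k}. bprob {0..n} q (\<lambda>S. misses j S \<and> misses k S) - ?p j * ?p k)
          \<le> (\<Sum>j\<in>K - {k}. ?p j * (e * ?p k))"
      proof (rule sum_mono)
        fix j assume "j \<in> K - {k}"
        then show "bprob {0..n} q (\<lambda>S. misses j S \<and> misses k S) - ?p j * ?p k \<le> ?p j * (e * ?p k)"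
          using bprob_misses_misses_le[OF q, of j k n] by (simp add: e_def algebra_simps)
      qed
      also have "\<dots> \<le> (\<Sum>j\<in>K. ?p j * (e * ?p k))"
        using K e0 p0 by (intro sum_mono2) auto
      also have "\<dots> = l * e * ?p k" unfolding l by (simp add: sum_distrib_right mult.assoc)
      finally show "(\<Sum>j\<in>K - {k}. bprob {0..n} q (\<lambda>S. misses j S \<and> misses k S) - ?p j * ?p k)
          \<le> l * e * ?p k" .
    qed (use l0 in simp)
    also have "\<dots> = M + l * e"
      using l0 unfolding sum.distrib sum_distrib_left[symmetric] l[symmetric]
      by (simp add: field_simps)
    also have "\<dots> \<le> M + ((2 * real n + 1) * M) * e"
      using lM e0 by (simp add: mult_right_mono)
    finally show ?thesis
      unfolding prob_missing_pmf[OF q(1) q1] num_missing_eq K_def by (simp add: algebra_simps)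
  qed
  then show ?thesis
    unfolding tv_dist_def l_def[symmetric] M_def e_def by (intro cSUP_least) auto
qed

section \<open>Asymptotics of the total variation distance\<close>

text \<open>With \<open>t = n q\<^sup>2\<close> the error of \<open>tv_dist_missing_le\<close> is of order \<open>n \<cdot> n q\<^sup>3 \<cdot> exp (- \<alpha> t / 2)\<close>,
  that is \<open>sqrt n \<cdot> t^(3/2) \<cdot> exp (- \<alpha> t / 2)\<close>, times \<open>exp (O(n q\<^sup>3))\<close>. The two factors that are
  subexponential in \<open>t\<close>, namely \<open>t^(3/2)\<close> and \<open>exp (O(n q\<^sup>3)) = exp (O(q) t)\<close>, are each absorbed into
  \<open>exp (\<eta> t)\<close>; what remains decreases in \<open>t\<close>, so \<open>t \<ge> c log n\<close> may be inserted.\<close>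

lemma tv_dist_missing_le_powr:
  assumes \<alpha>: "0 < \<alpha>" "\<alpha> < 1" and q: "0 \<le> q" "q \<le> 1/2"
    and n: "1 \<le> n" and \<eta>: "0 < \<eta>" "14 * q \<le> \<eta>" "2 * \<eta> \<le> \<alpha> / 2"
    and c: "c * ln (real n) \<le> real n * q\<^sup>2" and t1: "1 \<le> real n * q\<^sup>2"
  shows "tv_dist (missing_pmf \<alpha> n q) (poisson_pmf (mean_missing \<alpha> n q))
    \<le> (1 + 84 / \<eta>\<^sup>2) * real n powr (1 / 2 - (\<alpha> / 2 - 2 * \<eta>) * c)"
proof -
  define t where "t = real n * q\<^sup>2"
  define y where "y = 4 * (real n + 1) * q ^ 3 + 6 * q\<^sup>2"
  define z where "z = sqrt (real n) * exp ((2 * \<eta> - \<alpha> / 2) * t)"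
  have n1: "1 \<le> real n" using n by simp
  have t: "1 \<le> t" using t1 by (simp add: t_def)
  have rt: "sqrt t = sqrt (real n) * q" using q by (simp add: t_def real_sqrt_mult)
  have nq: "1 \<le> real n * q"
  proof -
    have "1 * 1 \<le> sqrt (real n) * sqrt t"
      using t n1 by (intro mult_mono) auto
    then show ?thesis by (simp add: rt mult.assoc[symmetric])
  qed
  have y0: "0 \<le> y" using q by (simp add: y_def)
  have y: "y \<le> 14 * (real n * q ^ 3)"
  proof -
    have "q\<^sup>2 * 1 \<le> q\<^sup>2 * (real n * q)" using nq by (intro mult_left_mono) auto
    then have "q\<^sup>2 \<le> real n * q ^ 3" by (simp add: power2_eq_square power3_eq_cube mult_ac)
    moreover have "1 * q ^ 3 \<le> real n * q ^ 3" using n1 q by (intro mult_right_mono) auto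
    ultimately show ?thesis by (simp add: y_def algebra_simps)
  qed
  have y\<eta>: "y \<le> \<eta> * t"
  proof -
    have "14 * q * t \<le> \<eta> * t" using \<eta> t by (intro mult_right_mono) auto
    then show ?thesis using y by (simp add: t_def power2_eq_square power3_eq_cube mult_ac)
  qed
  \<comment> \<open>Uses \<open>exp y - 1 \<le> y exp y\<close>, which is \<open>1 - y \<le> exp (- y)\<close> multiplied by \<open>exp y\<close>.\<close>
  have e: "exp y - 1 \<le> 14 * (real n * q ^ 3) * exp (\<eta> * t)"
  proof -
    have "exp y * (1 + - y) \<le> exp y * exp (- y)"
      by (intro mult_left_mono exp_ge_add_one_self) auto
    then have "exp y - 1 \<le> y * exp y" by (simp add: exp_minus_inverse algebra_simps)
    also have "\<dots> \<le> 14 * (real n * q ^ 3) * exp (\<eta> * t)"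
      using y y0 y\<eta> by (intro mult_mono) auto
    finally show ?thesis .
  qed
  have cube: "real n * (real n * q ^ 3) \<le> sqrt (real n) * (2 / \<eta>\<^sup>2 * exp (\<eta> * t))"
  proof -
    have "real n * (real n * q ^ 3) = (sqrt (real n) * sqrt (real n)) * t * q"
      by (simp add: t_def power2_eq_square power3_eq_cube)
    also have "\<dots> = sqrt (real n) * (t * sqrt t)"
      unfolding rt by (simp only: mult_ac)
    finally have "real n * (real n * q ^ 3) = sqrt (real n) * (t * sqrt t)" .
    also have "t * sqrt t \<le> t * t"
      using t by (intro mult_left_mono) (auto intro!: real_le_lsqrt self_le_power)
    also have "t * t \<le> 2 / \<eta>\<^sup>2 * exp (\<eta> * t)"
    proof -
      have "1 + \<eta> * t + (\<eta> * t)\<^sup>2 / 2 \<le> exp (\<eta> * t)"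
        using \<eta> t by (intro exp_lower_Taylor_quadratic) auto
      moreover have "0 \<le> \<eta> * t" using \<eta> t by simp
      ultimately have "(\<eta> * t)\<^sup>2 / 2 \<le> exp (\<eta> * t)" by linarith
      then show ?thesis using \<eta> by (simp add: field_simps power2_eq_square)
    qed
    finally show ?thesis by (simp add: mult_left_mono)
  qed
  have "(2 * real n + 1) * (exp y - 1) \<le> (3 * real n) * (14 * (real n * q ^ 3) * exp (\<eta> * t))"
    using e n1 y0 by (intro mult_mono) auto
  also have "\<dots> = 42 * exp (\<eta> * t) * (real n * (real n * q ^ 3))" by simp
  also have "\<dots> \<le> 42 * exp (\<eta> * t) * (sqrt (real n) * (2 / \<eta>\<^sup>2 * exp (\<eta> * t)))"
    using cube by (rule mult_left_mono) simp
  also have "\<dots> = 84 / \<eta>\<^sup>2 * (sqrt (real n) * exp (2 * \<eta> * t))"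
    by (simp add: exp_add[symmetric] mult_ac)
  finally have "exp (- \<alpha> * t / 2) * (1 + (2 * real n + 1) * (exp y - 1))
      \<le> exp (- \<alpha> * t / 2) * (1 + 84 / \<eta>\<^sup>2 * (sqrt (real n) * exp (2 * \<eta> * t)))"
    by (intro mult_left_mono add_left_mono) auto
  also have "\<dots> = exp (- \<alpha> * t / 2) + 84 / \<eta>\<^sup>2 * z"
  proof -
    have "exp (- \<alpha> * t / 2) * exp (2 * \<eta> * t) = exp ((2 * \<eta> - \<alpha> / 2) * t)"
      by (simp add: exp_add[symmetric] algebra_simps)
    then show ?thesis by (simp add: z_def algebra_simps)
  qed
  also have "exp (- \<alpha> * t / 2) \<le> z"
  proof -
    have "1 * exp (- \<alpha> * t / 2) \<le> z"
      unfolding z_def using n1 \<eta> t by (intro mult_mono) (auto simp: algebra_simps)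
    then show ?thesis by simp
  qed
  finally have "exp (- \<alpha> * t / 2) * (1 + (2 * real n + 1) * (exp y - 1)) \<le> (1 + 84 / \<eta>\<^sup>2) * z"
    by (simp add: algebra_simps)
  also have "z \<le> real n powr (1 / 2 - (\<alpha> / 2 - 2 * \<eta>) * c)"
  proof -
    have "(\<alpha> / 2 - 2 * \<eta>) * (c * ln (real n)) \<le> (\<alpha> / 2 - 2 * \<eta>) * t"
      using c \<eta> by (intro mult_left_mono) (auto simp: t_def)
    then have "exp ((2 * \<eta> - \<alpha> / 2) * t) \<le> exp (- ((\<alpha> / 2 - 2 * \<eta>) * c) * ln (real n))"
      by (simp add: algebra_simps)
    also have "\<dots> = real n powr (- ((\<alpha> / 2 - 2 * \<eta>) * c))"
      using n by (simp add: powr_def)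
    finally have "z \<le> real n powr (1 / 2) * real n powr (- ((\<alpha> / 2 - 2 * \<eta>) * c))"
      unfolding z_def using n by (simp add: powr_half_sqrt mult_left_mono)
    then show ?thesis by (simp add: powr_add[symmetric])
  qed
  finally have "exp (- \<alpha> * t / 2) * (1 + (2 * real n + 1) * (exp y - 1))
      \<le> (1 + 84 / \<eta>\<^sup>2) * real n powr (1 / 2 - (\<alpha> / 2 - 2 * \<eta>) * c)"
    by (simp add: mult_left_mono)
  then show ?thesis
    using tv_dist_missing_le[OF \<alpha> q, of n] by (simp add: t_def y_def mult.assoc)
qed

text \<open>Since \<open>\<alpha> c / 2 = 1 / 2 + \<alpha> \<delta> / 2\<close> for \<open>c = 1 / \<alpha> + \<delta>\<close>, the exponent in
  \<open>tv_dist_missing_le_powr\<close> is negative for small \<open>\<eta>\<close>.\<close>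

lemma tv_dist_missing_tendsto_0:
  assumes \<alpha>: "0 < \<alpha>" "\<alpha> < 1"
    and p01: "\<forall>\<^sub>F n in sequentially. 0 \<le> p n \<and> p n \<le> 1" and p0: "p \<longlonglongrightarrow> 0"
    and \<delta>: "0 < \<delta>"
    and large: "\<forall>\<^sub>F n in sequentially. p n \<ge> sqrt ((1 / \<alpha> + \<delta>) * ln (real n) / real n)"
  shows "(\<lambda>n. tv_dist (missing_pmf \<alpha> n (p n)) (poisson_pmf (mean_missing \<alpha> n (p n)))) \<longlonglongrightarrow> 0"
proof -
  define c where "c = 1 / \<alpha> + \<delta>"
  \<comment> \<open>This \<open>\<eta>\<close> spends half of the margin \<open>\<alpha> \<delta> / 2\<close> in the exponent.\<close>
  define \<eta> where "\<eta> = \<alpha> * \<delta> / (8 * c)"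
  have c: "0 < c" "\<delta> < c" using \<alpha> \<delta> by (auto simp: c_def add_pos_pos)
  have \<eta>: "0 < \<eta>" using \<alpha> \<delta> c by (simp add: \<eta>_def)
  have "\<alpha> * \<delta> \<le> \<alpha> * c" using \<alpha> c by (intro mult_left_mono) auto
  then have \<eta>2: "2 * \<eta> \<le> \<alpha> / 2" using c \<alpha> by (simp add: \<eta>_def field_simps)
  have expo: "1 / 2 - (\<alpha> / 2 - 2 * \<eta>) * c = - (\<alpha> * \<delta> / 4)"
  proof -
    have "\<eta> * c = \<alpha> * \<delta> / 8" using c by (simp add: \<eta>_def)
    moreover have "\<alpha> * c = 1 + \<alpha> * \<delta>" using \<alpha> by (simp add: c_def algebra_simps)
    ultimately show ?thesis by (simp add: algebra_simps)
  qed
  have ev_small: "\<forall>\<^sub>F n in sequentially. p n < min (1 / 2) (\<eta> / 14)"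
    using p0 \<eta> by (intro order_tendstoD) auto
  have ev_log: "\<forall>\<^sub>F n in sequentially. 1 / c < ln (real n)"
    by real_asymp
  have ev: "\<forall>\<^sub>F n in sequentially.
     tv_dist (missing_pmf \<alpha> n (p n)) (poisson_pmf (mean_missing \<alpha> n (p n)))
       \<le> (1 + 84 / \<eta>\<^sup>2) * real n powr (- (\<alpha> * \<delta> / 4))"
    using p01 large ev_small ev_log eventually_ge_at_top[of 1]
  proof eventually_elim
    case (elim n)
    have "0 \<le> c * ln (real n) / real n" using c elim by simp
    then have "c * ln (real n) / real n = (sqrt (c * ln (real n) / real n))\<^sup>2" by simp
    also have "\<dots> \<le> (p n)\<^sup>2"
      using elim c by (intro power_mono) (auto simp: c_def)
    finally have c1: "c * ln (real n) \<le> real n * (p n)\<^sup>2"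
      using elim by (simp add: field_simps)
    have "1 \<le> c * ln (real n)" using elim c by (simp add: field_simps)
    then show ?case
      using tv_dist_missing_le_powr[OF \<alpha>, of "p n" n \<eta> c] elim \<eta> \<eta>2 c1
      unfolding expo by simp
  qed
  have lim: "(\<lambda>n. (1 + 84 / \<eta>\<^sup>2) * real n powr (- (\<alpha> * \<delta> / 4))) \<longlonglongrightarrow> 0"
    using \<alpha> \<delta> by (intro tendsto_mult_right_zero tendsto_neg_powr filterlim_real_sequentially) auto
  show ?thesis
    by (rule tendsto_sandwich[OF _ ev tendsto_const lim]) (simp add: tv_dist_nonneg)
qed

section \<open>Asymptotics of the mean\<close>

text \<open>With \<open>r = sqrt (1 - q\<^sup>2)\<close> this agrees with the mean up to a factor in \<open>[1 - q, 1]\<close>, but it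
  is free of the parity distinctions of \<open>bprob_misses_eq\<close>.\<close>

definition dominant_sum :: "real \<Rightarrow> nat \<Rightarrow> real \<Rightarrow> real" where
  "dominant_sum \<alpha> n r = (\<Sum>k\<in>targets \<alpha> n. r ^ min k (2 * n - k))"

lemma mean_missing_bounds:
  assumes "0 < \<alpha>" "0 \<le> q" "q \<le> 1"
  shows "mean_missing \<alpha> n q \<le> dominant_sum \<alpha> n (sqrt (1 - q\<^sup>2))"
    and "(1 - q) * dominant_sum \<alpha> n (sqrt (1 - q\<^sup>2)) \<le> mean_missing \<alpha> n q"
  unfolding mean_missing_eq[OF assms] dominant_sum_def sum_distrib_left
  using bprob_misses_bounds[OF assms(2,3)] targets_le(1)[OF assms(1)] by (auto intro!: sum_mono)

text \<open>The symmetry \<open>k \<mapsto> 2 n - k\<close> of the targets folds the sum onto \<open>k \<le> n\<close>, leaving two geometric series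
  that start at the least integer \<open>\<ge> \<alpha> n\<close>.\<close>

lemma dominant_sum_geometric:
  assumes "0 < \<alpha>" "\<alpha> < 1" "1 \<le> n"
  shows "(1 - r) * dominant_sum \<alpha> n r = 2 * r ^ nat \<lceil>\<alpha> * real n\<rceil> - r ^ n - r ^ Suc n"
proof -
  define m where "m = nat \<lceil>\<alpha> * real n\<rceil>"
  have an: "\<alpha> * real n \<le> real n" using assms by (simp add: mult_left_le_one_le)
  have mn: "m \<le> n" unfolding m_def using an by linarith
  have m_le: "m \<le> k \<longleftrightarrow> \<alpha> * real n \<le> real k" for k
    unfolding m_def by linarith
  have "targets \<alpha> n = {k. m \<le> k \<and> k + m \<le> 2 * n}"
  proof -
    have "\<alpha> * real n \<le> real k \<and> real k \<le> (2 - \<alpha>) * real n \<longleftrightarrow> m \<le> k \<and> k + m \<le> 2 * n" for k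
    proof (cases "k \<le> 2 * n")
      case True
      then have "real k \<le> (2 - \<alpha>) * real n \<longleftrightarrow> \<alpha> * real n \<le> real (2 * n - k)"
        by (simp add: of_nat_diff algebra_simps)
      then show ?thesis using True m_le[of k] m_le[of "2 * n - k"] by auto
    next
      case False
      then have "real k > 2 * real n" by linarith
      moreover have "(2 - \<alpha>) * real n \<le> 2 * real n" using assms by (simp add: algebra_simps)
      ultimately show ?thesis using False by auto
    qed
    then show ?thesis by (simp add: targets_def)
  qed
  also have "\<dots> = {m..n} \<union> (\<lambda>l. 2 * n - l) ` {m..<n}"
  proof (intro equalityI subsetI)
    fix k assume k: "k \<in> {k. m \<le> k \<and> k + m \<le> 2 * n}"
    show "k \<in> {m..n} \<union> (\<lambda>l. 2 * n - l) ` {m..<n}"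
    proof (cases "k \<le> n")
      case False
      then have "k = 2 * n - (2 * n - k)" "2 * n - k \<in> {m..<n}" using k by auto
      then show ?thesis by blast
    qed (use k in auto)
  qed (use mn in auto)
  finally have "dominant_sum \<alpha> n r
      = (\<Sum>k\<in>{m..n}. r ^ min k (2 * n - k)) + (\<Sum>k\<in>(\<lambda>l. 2 * n - l) ` {m..<n}. r ^ min k (2 * n - k))"
    unfolding dominant_sum_def by (simp only:) (subst sum.union_disjoint, auto)
  also have "(\<Sum>k\<in>{m..n}. r ^ min k (2 * n - k)) = (\<Sum>k=m..n. r ^ k)"
    by (intro sum.cong) (auto simp: min_def)
  also have "(\<Sum>k\<in>(\<lambda>l. 2 * n - l) ` {m..<n}. r ^ min k (2 * n - k)) = (\<Sum>l=m..<n. r ^ l)"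
    by (subst sum.reindex) (auto simp: inj_on_def min_def intro!: sum.cong)
  also have "(\<Sum>k=m..n. r ^ k) = (\<Sum>l=m..<n. r ^ l) + r ^ n"
    using mn by (simp add: sum.last_plus algebra_simps)
  finally have *: "dominant_sum \<alpha> n r = 2 * (\<Sum>l=m..<n. r ^ l) + r ^ n" by simp
  have "(1 - r) * (\<Sum>l=m..<n. r ^ l) = r ^ m - r ^ n"
    using sum_Suc_diff'[OF mn, of "\<lambda>l. - (r ^ l)"]
    by (simp add: sum_distrib_left algebra_simps)
  then have "(1 - r) * dominant_sum \<alpha> n r = 2 * (r ^ m - r ^ n) + (1 - r) * r ^ n"
    unfolding * by (simp add: algebra_simps)
  then show ?thesis by (simp add: m_def algebra_simps)
qed

text \<open>The value of \<open>n p\<^sup>2\<close> in the second part; the terms are chosen so that \<open>exp (- \<alpha> n p\<^sup>2 / 2)\<close> becomes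
  \<open>log n / n\<close> times a function of \<open>a\<close> (\<open>exp_window\<close>).\<close>

definition window :: "real \<Rightarrow> nat \<Rightarrow> real \<Rightarrow> real" where
  "window \<alpha> n a = 2 / \<alpha> * ln (real n) - 2 / \<alpha> * ln (ln (real n)) + a"

lemma exp_window:
  assumes "0 < \<alpha>" "1 < n"
  shows "exp (- \<alpha> * window \<alpha> n a / 2) = ln (real n) / real n * exp (- \<alpha> * a / 2)"
proof -
  have "- \<alpha> * window \<alpha> n a / 2 = ln (ln (real n)) - ln (real n) + - \<alpha> * a / 2"
    using assms by (simp add: window_def field_simps)
  then show ?thesis
    using assms by (simp only: exp_add exp_diff) simp
qed

text \<open>With \<open>r = sqrt (1 - q\<^sup>2)\<close> this shows that the denominator \<open>1 - r\<close> of the geometric series is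
  asymptotic to \<open>q\<^sup>2 / 2\<close>.\<close>

lemma one_minus_sqrt_eq:
  assumes "0 \<le> q" "q \<le> (1::real)"
  shows "(1 - sqrt (1 - q\<^sup>2)) * (1 + sqrt (1 - q\<^sup>2)) = q\<^sup>2"
proof -
  have "(sqrt (1 - q\<^sup>2))\<^sup>2 = 1 - q\<^sup>2" using assms by (simp add: power_le_one)
  then show ?thesis by (simp add: algebra_simps power2_eq_square)
qed

lemma mean_missing_le_exp:
  assumes \<alpha>: "0 < \<alpha>" "\<alpha> < 1" and q: "0 < q" "q \<le> 1" and n: "1 \<le> n"
  shows "mean_missing \<alpha> n q \<le> 4 / q\<^sup>2 * exp (- (\<alpha> * real n) * q\<^sup>2 / 2)"
proof -
  define r where "r = sqrt (1 - q\<^sup>2)"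
  define L where "L = dominant_sum \<alpha> n r"
  have r: "0 \<le> r" "r \<le> 1" using q by (auto simp: r_def power_le_one)
  have L0: "0 \<le> L" unfolding L_def dominant_sum_def using r by (intro sum_nonneg) auto
  have "q\<^sup>2 = (1 - r) * (1 + r)" using one_minus_sqrt_eq[of q] q by (simp add: r_def)
  also have "\<dots> \<le> (1 - r) * 2" using r by (intro mult_left_mono) auto
  finally have "q\<^sup>2 / 2 * L \<le> (1 - r) * L" using L0 by (intro mult_right_mono) auto
  also have "\<dots> \<le> 2 * r ^ nat \<lceil>\<alpha> * real n\<rceil>"
    using zero_le_power[OF r(1), of n] zero_le_power[OF r(1), of "Suc n"]
    unfolding L_def dominant_sum_geometric[OF \<alpha> n] by linarith
  also have "r ^ nat \<lceil>\<alpha> * real n\<rceil> \<le> exp (- (\<alpha> * real n) * q\<^sup>2 / 2)"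
    unfolding r_def using q by (intro sqrt_one_minus_power_le) (auto simp: real_nat_ceiling_ge)
  finally have "L \<le> 4 / q\<^sup>2 * exp (- (\<alpha> * real n) * q\<^sup>2 / 2)"
    using q by (simp add: field_simps)
  then show ?thesis
    using mean_missing_bounds(1)[of \<alpha> q n] \<alpha> q by (simp add: L_def r_def)
qed

text \<open>The converse of \<open>sqrt_one_minus_power_le\<close>, with an error factor that tends to \<open>1\<close> when \<open>q\<close> and
  \<open>x q\<^sup>4\<close> tend to \<open>0\<close>; the slack \<open>x + 1\<close> accommodates rounding \<open>x\<close> up to an integer.\<close>

lemma sqrt_one_minus_power_ge:
  assumes q: "0 \<le> q" "q\<^sup>2 \<le> 1 / 2" and m: "real m \<le> x + 1"
  shows "exp (- x * q\<^sup>2 / 2) * exp (- (q\<^sup>2 / 2 + (x + 1) * q ^ 4)) \<le> sqrt (1 - q\<^sup>2) ^ m"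
proof -
  have "- q\<^sup>2 - 2 * (q\<^sup>2)\<^sup>2 \<le> ln (1 - q\<^sup>2)"
    using q by (intro ln_one_minus_pos_lower_bound) auto
  then have ln: "- (q\<^sup>2 + 2 * q ^ 4) \<le> ln (1 - q\<^sup>2)" by simp
  have "real m * (q\<^sup>2 + 2 * q ^ 4) \<le> (x + 1) * (q\<^sup>2 + 2 * q ^ 4)"
    using m by (intro mult_right_mono) auto
  moreover have "real m * - (q\<^sup>2 + 2 * q ^ 4) \<le> real m * ln (1 - q\<^sup>2)"
    using ln by (intro mult_left_mono) auto
  ultimately have "- x * q\<^sup>2 / 2 + - (q\<^sup>2 / 2 + (x + 1) * q ^ 4) \<le> real m * ln (1 - q\<^sup>2) / 2"
    by (simp add: algebra_simps)
  then have "exp (- x * q\<^sup>2 / 2 + - (q\<^sup>2 / 2 + (x + 1) * q ^ 4)) \<le> exp (real m * (ln (1 - q\<^sup>2) / 2))"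
    by simp
  also have "\<dots> = exp (ln (1 - q\<^sup>2) / 2) ^ m"
    by (rule exp_of_nat_mult)
  also have "exp (ln (1 - q\<^sup>2) / 2) = sqrt (1 - q\<^sup>2)"
    using q by (simp add: ln_sqrt[symmetric])
  finally show ?thesis by (simp only: exp_add)
qed

section \<open>The three regimes for truncated bases\<close>

text \<open>Eventually \<open>n p\<^sup>2 \<ge> log n / \<alpha>\<close>, so that the mean is at most \<open>4 \<alpha> exp (- \<alpha> A\<^sub>n / 2)\<close>, and the first moment
  bound applies.\<close>

lemma prob_truncated_2_basis_tendsto_1:
  fixes p A :: "nat \<Rightarrow> real"
  assumes \<alpha>: "0 < \<alpha>" "\<alpha> < 1"
    and p01: "\<forall>\<^sub>F n in sequentially. 0 \<le> p n \<and> p n \<le> 1"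
    and win: "\<forall>\<^sub>F n in sequentially. real n * (p n)\<^sup>2 = window \<alpha> n (A n)"
    and A: "filterlim A at_top sequentially"
  shows "(\<lambda>n. measure_pmf.prob (random_subset n (p n)) {S. truncated_2_basis \<alpha> n S}) \<longlonglongrightarrow> 1"
proof -
  have lnln: "\<forall>\<^sub>F n in sequentially. ln (ln (real n)) \<le> ln (real n) / 2"
    by real_asymp
  have A0: "\<forall>\<^sub>F n in sequentially. 0 \<le> A n"
    using A by (simp add: filterlim_at_top)
  have ev: "\<forall>\<^sub>F n in sequentially. 1 - 4 * \<alpha> * exp (- \<alpha> * A n / 2)
      \<le> measure_pmf.prob (random_subset n (p n)) {S. truncated_2_basis \<alpha> n S}"
    using p01 win lnln A0 eventually_gt_at_top[of 1]
  proof eventually_elim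
    case (elim n)
    have ln: "0 < ln (real n)" using elim by simp
    have "ln (real n) / \<alpha> \<le> window \<alpha> n (A n)"
      using elim \<alpha> mult_left_mono[OF elim(3), of "2 / \<alpha>"] by (simp add: window_def)
    then have ge: "ln (real n) / \<alpha> \<le> real n * (p n)\<^sup>2" using elim by simp
    have q: "0 < p n"
    proof (rule ccontr)
      assume "\<not> 0 < p n"
      then have "p n = 0" using elim by simp
      moreover have "0 < ln (real n) / \<alpha>" using ln \<alpha> by simp
      ultimately show False using ge by simp
    qed
    have "mean_missing \<alpha> n (p n) \<le> 4 / (p n)\<^sup>2 * exp (- (\<alpha> * real n) * (p n)\<^sup>2 / 2)"
      using \<alpha> q elim by (intro mean_missing_le_exp) auto
    also have "- (\<alpha> * real n) * (p n)\<^sup>2 / 2 = - \<alpha> * window \<alpha> n (A n) / 2"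
      using elim(2) by (simp add: mult.assoc)
    also have "4 / (p n)\<^sup>2 * exp (- \<alpha> * window \<alpha> n (A n) / 2)
        = 4 * exp (- \<alpha> * A n / 2) * (ln (real n) / (real n * (p n)\<^sup>2))"
      using \<alpha> elim(5) by (subst exp_window) (auto simp: mult_ac)
    also have "\<dots> \<le> 4 * exp (- \<alpha> * A n / 2) * \<alpha>"
    proof (rule mult_left_mono)
      have "0 < real n * (p n)\<^sup>2" by (rule mult_pos_pos) (use q elim in auto)
      then show "ln (real n) / (real n * (p n)\<^sup>2) \<le> \<alpha>"
        using ge \<alpha> by (simp add: divide_le_eq mult.commute)
    qed simp
    finally have "1 - 4 * \<alpha> * exp (- \<alpha> * A n / 2) \<le> 1 - mean_missing \<alpha> n (p n)"
      by (simp add: mult_ac)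
    also have "\<dots> \<le> measure_pmf.prob (random_subset n (p n)) {S. truncated_2_basis \<alpha> n S}"
      using \<alpha> elim by (intro prob_truncated_2_basis_ge) auto
    finally show ?case .
  qed
  have "filterlim (\<lambda>n. - \<alpha> / 2 * A n) at_bot sequentially"
    using \<alpha> by (intro filterlim_tendsto_neg_mult_at_bot[OF tendsto_const _ A]) auto
  then have "((\<lambda>n. exp (- \<alpha> / 2 * A n)) \<longlonglongrightarrow> 0)"
    by (rule filterlim_compose[OF exp_at_bot])
  then have "(\<lambda>n. 1 - 4 * \<alpha> * exp (- \<alpha> / 2 * A n)) \<longlonglongrightarrow> 1 - 4 * \<alpha> * 0"
    by (intro tendsto_intros)
  then have lim: "(\<lambda>n. 1 - 4 * \<alpha> * exp (- \<alpha> * A n / 2)) \<longlonglongrightarrow> 1" by simp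
  show ?thesis
    by (rule tendsto_sandwich[OF ev _ lim tendsto_const]) (simp add: measure_pmf.prob_le_1)
qed

lemma scaled_window_tendsto:
  assumes \<alpha>: "0 < \<alpha>"
    and win: "\<forall>\<^sub>F n in sequentially. t n = window \<alpha> n (A n)" and A: "A \<longlonglongrightarrow> a"
  shows "(\<lambda>n. t n / ln (real n)) \<longlonglongrightarrow> 2 / \<alpha>"
proof -
  have "(\<lambda>n. (ln (real n) - ln (ln (real n))) / ln (real n)) \<longlonglongrightarrow> 1" by real_asymp
  moreover have "filterlim (\<lambda>n. ln (real n)) at_top sequentially" by real_asymp
  then have "(\<lambda>n. A n / ln (real n)) \<longlonglongrightarrow> 0"
    by (intro tendsto_divide_0[OF A] filterlim_at_top_imp_at_infinity)
  ultimately have "(\<lambda>n. 2 / \<alpha> * ((ln (real n) - ln (ln (real n))) / ln (real n)) + A n / ln (real n))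
      \<longlonglongrightarrow> 2 / \<alpha> * 1 + 0"
    by (intro tendsto_intros)
  moreover have "\<forall>\<^sub>F n in sequentially. t n / ln (real n) =
      2 / \<alpha> * ((ln (real n) - ln (ln (real n))) / ln (real n)) + A n / ln (real n)"
    using win eventually_gt_at_top[of 1]
    by eventually_elim (use \<alpha> in \<open>simp add: window_def field_simps\<close>)
  ultimately show ?thesis by (simp add: tendsto_cong)
qed

text \<open>After multiplication by \<open>s = n / log n\<close> every ingredient of \<open>dominant_sum_geometric\<close> has a limit:
  the leading power of \<open>r\<close> tends to \<open>exp (- \<alpha> a / 2)\<close>, the powers near \<open>n\<close> vanish because \<open>\<alpha> < 1\<close>, and
  \<open>(1 - r) s\<close> tends to \<open>1 / \<alpha>\<close>.\<close>

lemma mean_missing_critical_tendsto: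
  fixes p A :: "nat \<Rightarrow> real"
  assumes \<alpha>: "0 < \<alpha>" "\<alpha> < 1"
    and p01: "\<forall>\<^sub>F n in sequentially. 0 \<le> p n \<and> p n \<le> 1" and p0: "p \<longlonglongrightarrow> 0"
    and win: "\<forall>\<^sub>F n in sequentially. real n * (p n)\<^sup>2 = window \<alpha> n (A n)"
    and A: "A \<longlonglongrightarrow> a"
  shows "(\<lambda>n. mean_missing \<alpha> n (p n)) \<longlonglongrightarrow> 2 * \<alpha> * exp (- \<alpha> * a / 2)"
proof -
  define t where "t n = real n * (p n)\<^sup>2" for n
  define s where "s n = real n / ln (real n)" for n :: nat
  define r where "r n = sqrt (1 - (p n)\<^sup>2)" for n
  define m where "m n = nat \<lceil>\<alpha> * real n\<rceil>" for n
  define E where "E n = exp (- \<alpha> * t n / 2) * s n" for n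
  have twin: "\<forall>\<^sub>F n in sequentially. t n = window \<alpha> n (A n)" using win by (simp add: t_def)
  note tl = scaled_window_tendsto[OF \<alpha>(1) twin A]
  have ln_top: "filterlim (\<lambda>n. ln (real n)) at_top sequentially" by real_asymp
  have t_top: "filterlim t at_top sequentially"
  proof -
    have "filterlim (\<lambda>n. t n / ln (real n) * ln (real n)) at_top sequentially"
      using \<alpha> by (intro filterlim_tendsto_pos_mult_at_top[OF tl _ ln_top]) auto
    moreover have "\<forall>\<^sub>F n in sequentially. t n / ln (real n) * ln (real n) = t n"
      using eventually_gt_at_top[of 1] by eventually_elim auto
    ultimately show ?thesis by (simp cong: filterlim_cong)
  qed
  have q4: "(\<lambda>n. real n * (p n) ^ 4) \<longlonglongrightarrow> 0"
  proof -
    have "(\<lambda>n. ln (real n) ^ 2 / real n) \<longlonglongrightarrow> 0" by real_asymp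
    from tendsto_mult[OF tendsto_power[OF tl, of 2] this]
    have "(\<lambda>n. (t n / ln (real n))\<^sup>2 * (ln (real n) ^ 2 / real n)) \<longlonglongrightarrow> 0" by simp
    moreover have "\<forall>\<^sub>F n in sequentially.
        (t n / ln (real n))\<^sup>2 * (ln (real n) ^ 2 / real n) = real n * (p n) ^ 4"
      using eventually_gt_at_top[of 1]
      by eventually_elim (simp add: t_def power2_eq_square power4_eq_xxxx field_simps)
    ultimately show ?thesis by (simp add: tendsto_cong)
  qed
  have r1: "r \<longlonglongrightarrow> 1"
  proof -
    have "(\<lambda>n. r n) \<longlonglongrightarrow> sqrt (1 - 0\<^sup>2)" unfolding r_def by (intro tendsto_intros p0)
    then show ?thesis by simp
  qed
  have E: "E \<longlonglongrightarrow> exp (- \<alpha> * a / 2)"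
  proof -
    have "(\<lambda>n. exp (- \<alpha> * A n / 2)) \<longlonglongrightarrow> exp (- \<alpha> * a / 2)" by (intro tendsto_intros A) auto
    moreover have "\<forall>\<^sub>F n in sequentially. exp (- \<alpha> * A n / 2) = E n"
      using twin eventually_gt_at_top[of 1]
    proof eventually_elim
      case (elim n)
      then show ?case unfolding E_def s_def elim(1) exp_window[OF \<alpha>(1) elim(2)] by simp
    qed
    ultimately show ?thesis by (simp add: tendsto_cong)
  qed
  have rm: "(\<lambda>n. r n ^ m n * s n) \<longlonglongrightarrow> exp (- \<alpha> * a / 2)"
  proof (rule tendsto_sandwich[OF _ _ _ E])
    show "\<forall>\<^sub>F n in sequentially. r n ^ m n * s n \<le> E n"
      using p01 eventually_gt_at_top[of 1]
    proof eventually_elim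
      case (elim n)
      have "r n ^ m n \<le> exp (- (\<alpha> * real n) * (p n)\<^sup>2 / 2)"
        unfolding r_def m_def using elim
        by (intro sqrt_one_minus_power_le) (auto simp: real_nat_ceiling_ge)
      then show ?case
        unfolding E_def using elim by (intro mult_right_mono) (auto simp: t_def s_def mult.assoc)
    qed
    have "\<forall>\<^sub>F n in sequentially. (p n)\<^sup>2 < 1 / 2"
      using tendsto_power[OF p0, of 2] by (intro order_tendstoD(2)[where y = "0\<^sup>2"]) auto
    then show "\<forall>\<^sub>F n in sequentially.
        E n * exp (- ((p n)\<^sup>2 / 2 + (\<alpha> * (real n * p n ^ 4) + p n ^ 4))) \<le> r n ^ m n * s n"
      using p01 eventually_gt_at_top[of 1]
    proof eventually_elim
      case (elim n)
      have "exp (- (\<alpha> * real n) * (p n)\<^sup>2 / 2) * exp (- ((p n)\<^sup>2 / 2 + (\<alpha> * real n + 1) * p n ^ 4))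
          \<le> r n ^ m n"
        unfolding r_def
      proof (rule sqrt_one_minus_power_ge)
        have "0 \<le> \<alpha> * real n" using \<alpha> by simp
        then show "real (m n) \<le> \<alpha> * real n + 1" unfolding m_def by linarith
      qed (use elim in auto)
      then have "exp (- (\<alpha> * real n) * (p n)\<^sup>2 / 2) * exp (- ((p n)\<^sup>2 / 2 + (\<alpha> * real n + 1) * p n ^ 4)) * s n
          \<le> r n ^ m n * s n"
        using elim by (intro mult_right_mono) (auto simp: s_def)
      then show ?case by (simp add: E_def t_def algebra_simps)
    qed
    have "(\<lambda>n. E n * exp (- ((p n)\<^sup>2 / 2 + (\<alpha> * (real n * p n ^ 4) + p n ^ 4))))
        \<longlonglongrightarrow> exp (- \<alpha> * a / 2) * exp (- (0\<^sup>2 / 2 + (\<alpha> * 0 + 0 ^ 4)))"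
      by (intro tendsto_intros E p0 q4) auto
    then show "(\<lambda>n. E n * exp (- ((p n)\<^sup>2 / 2 + (\<alpha> * (real n * p n ^ 4) + p n ^ 4))))
        \<longlonglongrightarrow> exp (- \<alpha> * a / 2)" by simp
  qed
  have rn: "(\<lambda>n. r n ^ n * s n) \<longlonglongrightarrow> 0"
  proof (rule tendsto_sandwich[OF _ _ tendsto_const])
    show "\<forall>\<^sub>F n in sequentially. 0 \<le> r n ^ n * s n"
      using p01 eventually_gt_at_top[of 1]
      by eventually_elim (auto simp: r_def s_def power_le_one)
    show "\<forall>\<^sub>F n in sequentially. r n ^ n * s n \<le> E n * exp (- (1 - \<alpha>) / 2 * t n)"
      using p01 eventually_gt_at_top[of 1]
    proof eventually_elim
      case (elim n)
      have "r n ^ n \<le> exp (- real n * (p n)\<^sup>2 / 2)"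
        unfolding r_def using elim by (intro sqrt_one_minus_power_le) auto
      also have "\<dots> = exp (- \<alpha> * t n / 2) * exp (- (1 - \<alpha>) / 2 * t n)"
        unfolding exp_add[symmetric] t_def by (simp add: field_simps)
      finally have "r n ^ n * s n \<le> exp (- \<alpha> * t n / 2) * exp (- (1 - \<alpha>) / 2 * t n) * s n"
        using elim by (intro mult_right_mono) (auto simp: s_def)
      then show ?case by (simp add: E_def mult_ac)
    qed
    have "filterlim (\<lambda>n. - (1 - \<alpha>) / 2 * t n) at_bot sequentially"
      using \<alpha> by (intro filterlim_tendsto_neg_mult_at_bot[OF tendsto_const _ t_top]) auto
    then have "(\<lambda>n. exp (- (1 - \<alpha>) / 2 * t n)) \<longlonglongrightarrow> 0"
      by (rule filterlim_compose[OF exp_at_bot])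
    from tendsto_mult[OF E this]
    show "(\<lambda>n. E n * exp (- (1 - \<alpha>) / 2 * t n)) \<longlonglongrightarrow> 0" by simp
  qed
  define L where "L n = dominant_sum \<alpha> n (r n)" for n
  have L: "L \<longlonglongrightarrow> 2 * \<alpha> * exp (- \<alpha> * a / 2)"
  proof -
    have lim: "(\<lambda>n. (2 * (r n ^ m n * s n) - r n ^ n * s n - r n * (r n ^ n * s n))
          / (t n / ln (real n) / (1 + r n)))
        \<longlonglongrightarrow> (2 * exp (- \<alpha> * a / 2) - 0 - 1 * 0) / (2 / \<alpha> / (1 + 1))"
      using \<alpha> by (intro tendsto_intros rm rn r1 tl) auto
    have val: "(2 * exp (- \<alpha> * a / 2) - 0 - 1 * 0) / (2 / \<alpha> / (1 + 1)) = 2 * \<alpha> * exp (- \<alpha> * a / 2)"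
      using \<alpha> by simp
    have "\<forall>\<^sub>F n in sequentially. 0 < t n"
      using t_top by (simp add: filterlim_at_top_dense)
    then have eq: "\<forall>\<^sub>F n in sequentially.
        (2 * (r n ^ m n * s n) - r n ^ n * s n - r n * (r n ^ n * s n)) / (t n / ln (real n) / (1 + r n)) = L n"
      using p01 eventually_gt_at_top[of 1]
    proof eventually_elim
      case (elim n)
      have r0: "0 \<le> r n" using elim by (simp add: r_def power_le_one)
      have s: "0 < s n" using elim by (simp add: s_def)
      have sq: "(1 - r n) * (1 + r n) = (p n)\<^sup>2"
        unfolding r_def using elim by (intro one_minus_sqrt_eq) auto
      have d: "t n / ln (real n) / (1 + r n) = (1 - r n) * s n"
      proof -
        have "t n = real n * (1 - r n) * (1 + r n)" by (simp add: t_def sq[symmetric])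
        moreover have "1 + r n \<noteq> 0" using r0 by simp
        ultimately show ?thesis by (simp add: s_def)
      qed
      have ne: "(1 - r n) \<noteq> 0" using sq elim(1) by (auto simp: t_def)
      have "2 * (r n ^ m n * s n) - r n ^ n * s n - r n * (r n ^ n * s n)
          = (2 * r n ^ m n - r n ^ n - r n ^ Suc n) * s n" by (simp add: algebra_simps)
      also have "2 * r n ^ m n - r n ^ n - r n ^ Suc n = (1 - r n) * L n"
        unfolding L_def m_def using \<alpha> elim by (subst dominant_sum_geometric) auto
      finally show ?case unfolding d using s ne by simp
    qed
    show ?thesis using Lim_transform_eventually[OF lim eq] unfolding val .
  qed
  show ?thesis
  proof (rule tendsto_sandwich[OF _ _ _ L])
    show "\<forall>\<^sub>F n in sequentially. (1 - p n) * L n \<le> mean_missing \<alpha> n (p n)"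
      using p01 by eventually_elim (use \<alpha> in \<open>simp add: L_def r_def mean_missing_bounds\<close>)
    show "\<forall>\<^sub>F n in sequentially. mean_missing \<alpha> n (p n) \<le> L n"
      using p01 by eventually_elim (use \<alpha> in \<open>simp add: L_def r_def mean_missing_bounds\<close>)
    have "(\<lambda>n. (1 - p n) * L n) \<longlonglongrightarrow> (1 - 0) * (2 * \<alpha> * exp (- \<alpha> * a / 2))"
      by (intro tendsto_intros p0 L)
    then show "(\<lambda>n. (1 - p n) * L n) \<longlonglongrightarrow> 2 * \<alpha> * exp (- \<alpha> * a / 2)" by simp
  qed
qed

text \<open>The event is \<open>X = 0\<close>, whose Poisson probability is \<open>exp (- \<lambda>)\<close>. The critical window lies
  far above the threshold of \<open>tv_dist_missing_tendsto_0\<close>, because \<open>n p\<^sup>2 / log n\<close> tends to \<open>2 / \<alpha>\<close>.\<close>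

lemma prob_truncated_2_basis_critical:
  fixes p A :: "nat \<Rightarrow> real"
  assumes \<alpha>: "0 < \<alpha>" "\<alpha> < 1"
    and p01: "\<forall>\<^sub>F n in sequentially. 0 \<le> p n \<and> p n \<le> 1" and p0: "p \<longlonglongrightarrow> 0"
    and win: "\<forall>\<^sub>F n in sequentially. real n * (p n)\<^sup>2 = window \<alpha> n (A n)"
    and A: "A \<longlonglongrightarrow> a"
  shows "(\<lambda>n. measure_pmf.prob (random_subset n (p n)) {S. truncated_2_basis \<alpha> n S})
    \<longlonglongrightarrow> exp (- 2 * \<alpha> * exp (- \<alpha> * a / 2))"
proof -
  define d where "d n = tv_dist (missing_pmf \<alpha> n (p n)) (poisson_pmf (mean_missing \<alpha> n (p n)))" for n
  let ?P = "\<lambda>n. measure_pmf.prob (random_subset n (p n)) {S. truncated_2_basis \<alpha> n S}"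
  let ?e = "\<lambda>n. exp (- mean_missing \<alpha> n (p n))"
  have d: "d \<longlonglongrightarrow> 0"
    unfolding d_def
  proof (rule tv_dist_missing_tendsto_0[OF \<alpha> p01 p0])
    \<comment> \<open>Any \<open>\<delta>\<close> with \<open>1 / \<alpha> + \<delta> < 2 / \<alpha>\<close> serves; here \<open>\<delta> = 1 / (2 \<alpha>)\<close>.\<close>
    show "0 < 1 / (2 * \<alpha>)" using \<alpha> by simp
    have "\<forall>\<^sub>F n in sequentially. 1 / \<alpha> + 1 / (2 * \<alpha>) < real n * (p n)\<^sup>2 / ln (real n)"
      using scaled_window_tendsto[OF \<alpha>(1) win A] \<alpha> by (intro order_tendstoD) (auto simp: field_simps)
    then show "\<forall>\<^sub>F n in sequentially. sqrt ((1 / \<alpha> + 1 / (2 * \<alpha>)) * ln (real n) / real n) \<le> p n"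
      using p01 eventually_gt_at_top[of 1]
    proof eventually_elim
      case (elim n)
      have "(1 / \<alpha> + 1 / (2 * \<alpha>)) * ln (real n) \<le> real n * (p n)\<^sup>2"
        using elim by (simp add: pos_less_divide_eq)
      then have "(1 / \<alpha> + 1 / (2 * \<alpha>)) * ln (real n) / real n \<le> (p n)\<^sup>2"
        using elim(3) by (subst pos_divide_le_eq) (simp_all add: mult.commute[of "(p n)\<^sup>2"])
      then show ?case using elim by (intro real_le_lsqrt) auto
    qed
  qed
  have lim_e: "?e \<longlonglongrightarrow> exp (- (2 * \<alpha> * exp (- \<alpha> * a / 2)))"
    by (intro tendsto_intros mean_missing_critical_tendsto[OF assms])
  have ev: "\<forall>\<^sub>F n in sequentially. \<bar>?P n - ?e n\<bar> \<le> d n"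
    using p01 order_tendstoD(2)[OF p0, of 1, simplified]
  proof eventually_elim
    case (elim n)
    have "?P n = measure_pmf.prob (missing_pmf \<alpha> n (p n)) {0}"
      using elim \<alpha> by (simp add: prob_truncated_2_basis_eq prob_missing_pmf)
    moreover have "?e n = measure_pmf.prob (poisson_pmf (mean_missing \<alpha> n (p n))) {0}"
      using mean_missing_pos[OF \<alpha>, of "p n" n] elim by (simp add: measure_pmf_single)
    ultimately show ?case unfolding d_def by (simp only: abs_diff_le_tv_dist)
  qed
  have "(\<lambda>n. ?P n - ?e n) \<longlonglongrightarrow> 0"
    by (rule Lim_null_comparison[OF _ d]) (use ev in simp)
  from tendsto_add[OF this lim_e] show ?thesis by simp
qed

text \<open>Being a basis is an increasing event, so for every fixed \<open>a\<close> the probability is eventually at most the one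
  for the window with constant \<open>a\<close>; its limit is below any \<open>\<epsilon>\<close> if \<open>a\<close> is small enough.\<close>

lemma prob_truncated_2_basis_tendsto_0:
  fixes p A :: "nat \<Rightarrow> real"
  assumes \<alpha>: "0 < \<alpha>" "\<alpha> < 1"
    and p01: "\<forall>\<^sub>F n in sequentially. 0 \<le> p n \<and> p n \<le> 1"
    and win: "\<forall>\<^sub>F n in sequentially. real n * (p n)\<^sup>2 = window \<alpha> n (A n)"
    and A: "filterlim A at_bot sequentially"
  shows "(\<lambda>n. measure_pmf.prob (random_subset n (p n)) {S. truncated_2_basis \<alpha> n S}) \<longlonglongrightarrow> 0"
proof (rule order_tendstoI)
  let ?P = "\<lambda>p n. measure_pmf.prob (random_subset n (p n)) {S. truncated_2_basis \<alpha> n S}"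
  fix \<epsilon> :: real assume "0 < \<epsilon>"
  define c where "c = max 1 (1 - ln \<epsilon>)"
  \<comment> \<open>Solves \<open>2 \<alpha> exp (- \<alpha> a / 2) = c\<close>, and \<open>exp (- c) < \<epsilon>\<close>.\<close>
  define a where "a = - 2 / \<alpha> * ln (c / (2 * \<alpha>))"
  define p' where "p' n = sqrt (window \<alpha> n a / real n)" for n
  have c: "1 \<le> c" "- ln \<epsilon> < c" by (auto simp: c_def)
  have "- \<alpha> * a / 2 = ln (c / (2 * \<alpha>))" using \<alpha> by (simp add: a_def)
  then have "2 * \<alpha> * exp (- \<alpha> * a / 2) = c" using \<alpha> c by simp
  then have small: "exp (- 2 * \<alpha> * exp (- \<alpha> * a / 2)) < \<epsilon>"
  proof -
    have "exp (- c) < exp (ln \<epsilon>)" using c by simp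
    then show ?thesis using \<open>0 < \<epsilon>\<close> \<open>2 * \<alpha> * exp (- \<alpha> * a / 2) = c\<close> by simp
  qed
  have pos: "\<forall>\<^sub>F n in sequentially. 0 \<le> window \<alpha> n a"
  proof -
    have "\<forall>\<^sub>F n in sequentially. 0 < window \<alpha> n a / ln (real n)"
      using \<alpha> scaled_window_tendsto[OF \<alpha>(1), of "\<lambda>n. window \<alpha> n a" "\<lambda>_. a" a]
      by (intro order_tendstoD(1)[where y = "2 / \<alpha>"]) auto
    then show ?thesis using eventually_gt_at_top[of 1]
      by eventually_elim (auto simp: zero_less_divide_iff)
  qed
  have p'0: "p' \<longlonglongrightarrow> 0"
  proof -
    have "(\<lambda>n. ln (real n) / real n) \<longlonglongrightarrow> 0" "(\<lambda>n. ln (ln (real n)) / real n) \<longlonglongrightarrow> 0"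
      "(\<lambda>n. a / real n) \<longlonglongrightarrow> 0" by real_asymp+
    then have "(\<lambda>n. sqrt (2 / \<alpha> * (ln (real n) / real n) - 2 / \<alpha> * (ln (ln (real n)) / real n) + a / real n))
        \<longlonglongrightarrow> sqrt (2 / \<alpha> * 0 - 2 / \<alpha> * 0 + 0)"
      by (intro tendsto_intros)
    then show ?thesis
      unfolding p'_def window_def by (simp add: add_divide_distrib diff_divide_distrib)
  qed
  have p'01: "\<forall>\<^sub>F n in sequentially. 0 \<le> p' n \<and> p' n \<le> 1"
    using pos order_tendstoD(2)[OF p'0, of 1, simplified]
    by eventually_elim (auto simp: p'_def)
  have win': "\<forall>\<^sub>F n in sequentially. real n * (p' n)\<^sup>2 = window \<alpha> n a"
    using pos eventually_gt_at_top[of 0] by eventually_elim (auto simp: p'_def)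
  have "\<forall>\<^sub>F n in sequentially. ?P p' n < \<epsilon>"
    using prob_truncated_2_basis_critical[OF \<alpha> p'01 p'0 win' tendsto_const] small
    by (rule order_tendstoD)
  moreover have "\<forall>\<^sub>F n in sequentially. A n \<le> a" using A by (simp add: filterlim_at_bot)
  ultimately show "\<forall>\<^sub>F n in sequentially. ?P p n < \<epsilon>"
    using p01 p'01 win win' eventually_gt_at_top[of 0]
  proof eventually_elim
    case (elim n)
    have "real n * (p n)\<^sup>2 \<le> real n * (p' n)\<^sup>2"
      using elim by (simp add: window_def)
    moreover have "0 < real n" using elim by simp
    ultimately have "(p n)\<^sup>2 \<le> (p' n)\<^sup>2" by (simp only: mult_le_cancel_left_pos)
    then have "p n \<le> p' n" by (rule power2_le_imp_le) (use elim in simp)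
    then show ?case
      using prob_truncated_2_basis_mono[of \<alpha> "p n" "p' n" n] elim \<alpha> by linarith
  qed
qed (auto intro!: always_eventually less_le_trans[OF _ measure_nonneg])

theorem theorem5:
  fixes \<alpha> :: real and p :: "nat \<Rightarrow> real"
  assumes "0 < \<alpha>" and "\<alpha> < 1"
    and "\<forall>\<^sub>F n in sequentially. 0 \<le> p n \<and> p n \<le> 1"
    and "p \<longlonglongrightarrow> 0"
  shows
    "(\<forall>\<delta>>0.
        (\<forall>\<^sub>F n in sequentially. p n \<ge> sqrt ((1 / \<alpha> + \<delta>) * ln (real n) / real n))
        \<longrightarrow> (\<lambda>n. tv_dist (missing_pmf \<alpha> n (p n)) (poisson_pmf (mean_missing \<alpha> n (p n))))
              \<longlonglongrightarrow> 0)
     \<and>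
     (\<forall>A :: nat \<Rightarrow> real.
        (\<forall>\<^sub>F n in sequentially.
           p n = sqrt ((2 / \<alpha> * ln (real n) - 2 / \<alpha> * ln (ln (real n)) + A n) / real n))
        \<longrightarrow>
        (filterlim A at_top sequentially \<longrightarrow>
           (\<lambda>n. measure_pmf.prob (random_subset n (p n)) {S. truncated_2_basis \<alpha> n S})
             \<longlonglongrightarrow> 1)
        \<and>
        (filterlim A at_bot sequentially \<longrightarrow>
           (\<lambda>n. measure_pmf.prob (random_subset n (p n)) {S. truncated_2_basis \<alpha> n S})
             \<longlonglongrightarrow> 0)
        \<and>
        (\<forall>a. A \<longlonglongrightarrow> a \<longrightarrow>
           (\<lambda>n. measure_pmf.prob (random_subset n (p n)) {S. truncated_2_basis \<alpha> n S})
             \<longlonglongrightarrow> exp (- 2 * \<alpha> * exp (- \<alpha> * a / 2))))"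
proof -
  have win: "\<forall>\<^sub>F n in sequentially. real n * (p n)\<^sup>2 = window \<alpha> n (A n)"
    if "\<forall>\<^sub>F n in sequentially.
      p n = sqrt ((2 / \<alpha> * ln (real n) - 2 / \<alpha> * ln (ln (real n)) + A n) / real n)" for A
    using that assms(3) eventually_gt_at_top[of 0]
  proof eventually_elim
    case (elim n)
    then have eq: "p n = sqrt (window \<alpha> n (A n) / real n)" by (simp add: window_def)
    then have "0 \<le> window \<alpha> n (A n) / real n" using elim(2) by (simp only: real_sqrt_ge_0_iff)
    then have "(p n)\<^sup>2 = window \<alpha> n (A n) / real n" by (simp only: eq real_sqrt_pow2)
    then show ?case using elim(3) by simp
  qed
  show ?thesis
  proof (intro conjI allI impI)
    fix \<delta> :: real
    assume "0 < \<delta>" "\<forall>\<^sub>F n in sequentially. p n \<ge> sqrt ((1 / \<alpha> + \<delta>) * ln (real n) / real n)"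
    then show "(\<lambda>n. tv_dist (missing_pmf \<alpha> n (p n)) (poisson_pmf (mean_missing \<alpha> n (p n)))) \<longlonglongrightarrow> 0"
      by (rule tv_dist_missing_tendsto_0[OF assms])
  next
    fix A assume "\<forall>\<^sub>F n in sequentially.
      p n = sqrt ((2 / \<alpha> * ln (real n) - 2 / \<alpha> * ln (ln (real n)) + A n) / real n)"
    note w = win[OF this]
    show "(\<lambda>n. measure_pmf.prob (random_subset n (p n)) {S. truncated_2_basis \<alpha> n S}) \<longlonglongrightarrow> 1"
      if "filterlim A at_top sequentially"
      by (rule prob_truncated_2_basis_tendsto_1[OF assms(1-3) w that])
    show "(\<lambda>n. measure_pmf.prob (random_subset n (p n)) {S. truncated_2_basis \<alpha> n S}) \<longlonglongrightarrow> 0"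
      if "filterlim A at_bot sequentially"
      by (rule prob_truncated_2_basis_tendsto_0[OF assms(1-3) w that])
    show "(\<lambda>n. measure_pmf.prob (random_subset n (p n)) {S. truncated_2_basis \<alpha> n S})
        \<longlonglongrightarrow> exp (- 2 * \<alpha> * exp (- \<alpha> * a / 2))" if "A \<longlonglongrightarrow> a" for a
      by (rule prob_truncated_2_basis_critical[OF assms w that])
  qed
qed

end
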